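(* Let $M$ be a smooth manifold of dimension $2n+1$, let $\eta$ be a $1$-form on $M$, and let $L_\eta$ be the associated $\mathcal{E}^1(M)$-Dirac structure. Then $\eta$ is a contact $1$-form if and only if $$L_\eta\cap\big((TM\times\{0\})\oplus(\{0\}\times\mathbb{R})\big)$$ is a $1$-dimensional (i.e. rank one) sub-bundle of $\mathcal{E}^1(M)$ generated by an element of the form $(\xi,0)+(0,-1)$, where $\xi$ is a vector field on $M$.
   Context: $M$ is a smooth manifold. Let $\mathcal{E}^1(M)=(TM\times\mathbb{R})\oplus(T^*M\times\mathbb{R})$, a real vector bundle over $M$; its sections are written $(X,f)+(\alpha,g)$ with $X$ a vector field, $\alpha$ a $1$-form and $f,g\in C^\infty(M)$. Thus $(TM\times\{0\})\oplus(\{0\}\times\mathbb{R})$ is the sub-bundle whose sections are the $(X,0)+(0,g)$. The bundle $\mathcal{E}^1(M)$ carries the symmetric bilinear form $$\langle (X_1,f_1)+(\alpha_1,g_1),\,(X_2,f_2)+(\alpha_2,g_2)\rangle=\tfrac12\big(i_{X_2}\alpha_1+i_{X_1}\alpha_2+f_1g_2+f_2g_1\big).$$ For $k\ge 1$, $\alpha\in\Omega^k(M)$, $\beta\in\Omega^{k-1}(M)$ put $\widetilde d(\alpha,\beta)=(d\alpha,\,(-1)^k\alpha+d\beta)$, and for $f\in C^\infty(M)$ put $\widetilde d f=(df,f)$. For a vector field $X$ and $f\in C^\infty(M)$ put $i_{(X,f)}(\alpha,\beta)=(i_X\alpha+(-1)^{k+1}f\beta,\ i_X\beta)$ (for $k=1$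 this is the function $i_{(X,f)}(\alpha,g)=\alpha(X)+fg$). Put $\widetilde{\mathcal L}_{(X,f)}=i_{(X,f)}\circ\widetilde d+\widetilde d\circ i_{(X,f)}$. The extended Courant bracket on $\Gamma(\mathcal{E}^1(M))$ is $$[(X_1,f_1)+(\alpha_1,g_1),(X_2,f_2)+(\alpha_2,g_2)]=([X_1,X_2],\,X_1\cdot f_2-X_2\cdot f_1)+\widetilde{\mathcal L}_{(X_1,f_1)}(\alpha_2,g_2)-i_{(X_2,f_2)}\widetilde d(\alpha_1,g_1).$$ An $\mathcal{E}^1(M)$-Dirac structure is a sub-bundle $L\subset\mathcal{E}^1(M)$ that is maximally isotropic with respect to $\langle\cdot,\cdot\rangle$ and such that $\Gamma(L)$ is closed under the extended Courant bracket. For a $1$-form $\eta$ on $M$, $L_\eta$ is the $\mathcal{E}^1(M)$-Dirac structure with fibres $(L_\eta)_x=\{(X,f)_x+(i_Xd\eta+f\eta,\,-i_X\eta)_x : X \text{ a vector field on } M,\ f\in C^\infty(M)\}$. A $1$-form $\eta$ on a $(2n+1)$-dimensional manifold is contact if $\eta\wedge(d\eta)^n\neq0$ at every point. *)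

theory Defs
  imports
    "HOL-Analysis.Analysis"
    "HOL-Library.Function_Algebras"
    "HOL-Combinatorics.Permutations"
begin

section \<open>Smooth maps and smooth manifolds\<close>

(* The pointwise vector space structure on functions, so that the library notions
   subspace, span, independent apply to tangent and cotangent spaces below. *)
instantiation "fun" :: (type, real_vector) real_vector
begin

definition scaleR_fun :: "real \<Rightarrow> ('a \<Rightarrow> 'b) \<Rightarrow> 'a \<Rightarrow> 'b" where
  "scaleR_fun r f = (\<lambda>x. r *\<^sub>R f x)"

instance
  by standard (auto simp: scaleR_fun_def fun_eq_iff plus_fun_def scaleR_add_right scaleR_add_left)

end

(* C^k on an open set S *)
fun Ck_on :: "nat \<Rightarrow> 'a::real_normed_vector set \<Rightarrow> ('a \<Rightarrow> 'b::real_normed_vector) \<Rightarrow> bool" where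
  "Ck_on 0 S f \<longleftrightarrow> continuous_on S f"
| "Ck_on (Suc k) S f \<longleftrightarrow>
     (\<forall>x\<in>S. f differentiable (at x)) \<and> (\<forall>v. Ck_on k S (\<lambda>x. frechet_derivative f (at x) v))"

definition smooth_on :: "'a::real_normed_vector set \<Rightarrow> ('a \<Rightarrow> 'b::real_normed_vector) \<Rightarrow> bool" where
  "smooth_on S f \<longleftrightarrow> (\<forall>k. Ck_on k S f)"

(* A chart is a domain together with a coordinate map; the values of the coordinate map
   outside the domain are irrelevant. *)
type_synonym ('a, 'e) chart = "'a set \<times> ('a \<Rightarrow> 'e)"

definition chart_inv :: "('a, 'e) chart \<Rightarrow> 'e \<Rightarrow> 'a" where
  "chart_inv c = inv_into (fst c) (snd c)"

definition is_chart :: "('a::topological_space, 'e::euclidean_space) chart \<Rightarrow> bool" where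
  "is_chart c \<longleftrightarrow> open (fst c) \<and> open (snd c ` fst c) \<and>
     homeomorphism (fst c) (snd c ` fst c) (snd c) (chart_inv c)"

definition transition :: "('a, 'e) chart \<Rightarrow> ('a, 'e) chart \<Rightarrow> 'e \<Rightarrow> 'e" where
  "transition c c' y = snd c' (chart_inv c y)"

(* The underlying set of the manifold is the whole type 'a, A is an atlas (not necessarily
   maximal), and the dimension is DIM('e). *)
definition smooth_manifold ::
    "('a::{t2_space,second_countable_topology}, 'e::euclidean_space) chart set \<Rightarrow> bool" where
  "smooth_manifold A \<longleftrightarrow>
     (\<forall>c\<in>A. is_chart c) \<and> (\<Union>c\<in>A. fst c) = UNIV \<and>
     (\<forall>c\<in>A. \<forall>c'\<in>A. smooth_on (snd c ` (fst c \<inter> fst c')) (transition c c'))"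

section \<open>Tangent and cotangent spaces\<close>

definition charts_at :: "('a, 'e) chart set \<Rightarrow> 'a \<Rightarrow> ('a, 'e) chart set" where
  "charts_at A p = {c \<in> A. p \<in> fst c}"

(* A tangent vector at p is the family of its coordinate vectors in the charts around p,
   transforming under a change of charts by the derivative of the transition map;
   the family is 0 at the charts not containing p. *)
type_synonym ('a, 'e) tvec = "('a, 'e) chart \<Rightarrow> 'e"

definition tangent_space ::
    "('a, 'e::euclidean_space) chart set \<Rightarrow> 'a \<Rightarrow> ('a, 'e) tvec set" where
  "tangent_space A p = {v.
     (\<forall>c\<in>charts_at A p. \<forall>c'\<in>charts_at A p.
        v c' = frechet_derivative (transition c c') (at (snd c p)) (v c)) \<and>
     (\<forall>c. c \<notin> charts_at A p \<longrightarrow> v c = 0)}"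

(* the tangent vector at p whose coordinate vector in the chart c is w *)
definition coord_vec ::
    "('a, 'e::euclidean_space) chart set \<Rightarrow> ('a, 'e) chart \<Rightarrow> 'a \<Rightarrow> 'e \<Rightarrow> ('a, 'e) tvec" where
  "coord_vec A c p w = (\<lambda>c'. if c' \<in> charts_at A p
     then frechet_derivative (transition c c') (at (snd c p)) w else 0)"

type_synonym ('a, 'e) covec = "('a, 'e) tvec \<Rightarrow> real"

(* linear functionals on the tangent space, extended by 0 outside it *)
definition cotangent_space ::
    "('a, 'e::euclidean_space) chart set \<Rightarrow> 'a \<Rightarrow> ('a, 'e) covec set" where
  "cotangent_space A p = {\<alpha>.
     (\<forall>u\<in>tangent_space A p. \<forall>v\<in>tangent_space A p. \<alpha> (u + v) = \<alpha> u + \<alpha> v) \<and>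
     (\<forall>r. \<forall>u\<in>tangent_space A p. \<alpha> (r *\<^sub>R u) = r * \<alpha> u) \<and>
     (\<forall>u. u \<notin> tangent_space A p \<longrightarrow> \<alpha> u = 0)}"

section \<open>Functions, vector fields and 1-forms over an open subset W\<close>

definition smooth_fun ::
    "('a, 'e::euclidean_space) chart set \<Rightarrow> 'a set \<Rightarrow> ('a \<Rightarrow> real) \<Rightarrow> bool" where
  "smooth_fun A W f \<longleftrightarrow>
     (\<forall>c\<in>A. smooth_on (snd c ` (fst c \<inter> W)) (\<lambda>y. f (chart_inv c y)))"

definition vector_field ::
    "('a, 'e::euclidean_space) chart set \<Rightarrow> 'a set \<Rightarrow> ('a \<Rightarrow> ('a, 'e) tvec) \<Rightarrow> bool" where
  "vector_field A W X \<longleftrightarrow> (\<forall>p\<in>W. X p \<in> tangent_space A p) \<and>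
     (\<forall>c\<in>A. smooth_on (snd c ` (fst c \<inter> W)) (\<lambda>y. X (chart_inv c y) c))"

(* the coefficient function y \<mapsto> \<eta>(\<partial>\<^sub>w) of a 1-form \<eta> in the chart c *)
definition form_coeff ::
    "('a, 'e::euclidean_space) chart set \<Rightarrow> ('a \<Rightarrow> ('a, 'e) covec) \<Rightarrow> ('a, 'e) chart
      \<Rightarrow> 'e \<Rightarrow> 'e \<Rightarrow> real" where
  "form_coeff A \<eta> c w y = \<eta> (chart_inv c y) (coord_vec A c (chart_inv c y) w)"

definition one_form ::
    "('a, 'e::euclidean_space) chart set \<Rightarrow> 'a set \<Rightarrow> ('a \<Rightarrow> ('a, 'e) covec) \<Rightarrow> bool" where
  "one_form A W \<eta> \<longleftrightarrow> (\<forall>p\<in>W. \<eta> p \<in> cotangent_space A p) \<and>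
     (\<forall>c\<in>A. \<forall>w. smooth_on (snd c ` (fst c \<inter> W)) (form_coeff A \<eta> c w))"

(* d\<eta> of a 1-form, by the coordinate formula
     d\<eta>(u,v) = D\<^sub>u(\<eta>(\<partial>\<^sub>v)) - D\<^sub>v(\<eta>(\<partial>\<^sub>u)),
   that is (d\<eta>)\<^sub>i\<^sub>j = \<partial>\<^sub>i \<eta>\<^sub>j - \<partial>\<^sub>j \<eta>\<^sub>i without a factor 1/2.  For a 1-form the value does not
   depend on which chart around p is used; SOME only picks one. *)
definition ext_deriv ::
    "('a, 'e::euclidean_space) chart set \<Rightarrow> ('a \<Rightarrow> ('a, 'e) covec)
      \<Rightarrow> 'a \<Rightarrow> ('a, 'e) tvec \<Rightarrow> ('a, 'e) tvec \<Rightarrow> real" where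
  "ext_deriv A \<eta> p u v =
     (if u \<in> tangent_space A p \<and> v \<in> tangent_space A p then
        let c = (SOME c. c \<in> charts_at A p) in
          frechet_derivative (form_coeff A \<eta> c (v c)) (at (snd c p)) (u c)
          - frechet_derivative (form_coeff A \<eta> c (u c)) (at (snd c p)) (v c)
      else 0)"

section \<open>Exterior algebra and contact forms\<close>

(* A k-form on a vector space is a function of sequences of vectors that depends only on
   the entries 0, ..., k - 1. *)
definition wedge ::
    "nat \<Rightarrow> nat \<Rightarrow> ((nat \<Rightarrow> 'v) \<Rightarrow> real) \<Rightarrow> ((nat \<Rightarrow> 'v) \<Rightarrow> real) \<Rightarrow> (nat \<Rightarrow> 'v) \<Rightarrow> real" where
  "wedge k l \<alpha> \<beta> v =
     (\<Sum>\<sigma> | \<sigma> permutes {..<k + l}.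
        of_int (sign \<sigma>) * \<alpha> (\<lambda>i. v (\<sigma> i)) * \<beta> (\<lambda>i. v (\<sigma> (k + i)))) / (fact k * fact l)"

(* the j-th exterior power of the k-form \<alpha>, a (k * j)-form *)
primrec wedge_power ::
    "nat \<Rightarrow> ((nat \<Rightarrow> 'v) \<Rightarrow> real) \<Rightarrow> nat \<Rightarrow> (nat \<Rightarrow> 'v) \<Rightarrow> real" where
  "wedge_power k \<alpha> 0 = (\<lambda>v. 1)"
| "wedge_power k \<alpha> (Suc j) = wedge k (k * j) \<alpha> (wedge_power k \<alpha> j)"

definition contact_form ::
    "('a, 'e::euclidean_space) chart set \<Rightarrow> nat \<Rightarrow> ('a \<Rightarrow> ('a, 'e) covec) \<Rightarrow> bool" where
  "contact_form A n \<eta> \<longleftrightarrow>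
     (\<forall>p. \<exists>v. (\<forall>i < 2 * n + 1. v i \<in> tangent_space A p) \<and>
        wedge 1 (2 * n) (\<lambda>v. \<eta> p (v 0))
          (wedge_power 2 (\<lambda>v. ext_deriv A \<eta> p (v 0) (v 1)) n) v \<noteq> 0)"

section \<open>The bundle \<open>\<E>\<^sup>1(M) = (TM \<times> \<real>) \<oplus> (T\<^sup>*M \<times> \<real>)\<close>\<close>

(* (X,f) + (\<alpha>,g) is the pair ((X, f), (\<alpha>, g)) *)
type_synonym ('a, 'e) E1vec = "(('a, 'e) tvec \<times> real) \<times> (('a, 'e) covec \<times> real)"

definition E1_section ::
    "('a, 'e::euclidean_space) chart set \<Rightarrow> 'a set \<Rightarrow> ('a \<Rightarrow> ('a, 'e) E1vec) \<Rightarrow> bool" where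
  "E1_section A W s \<longleftrightarrow>
     vector_field A W (\<lambda>p. fst (fst (s p))) \<and> smooth_fun A W (\<lambda>p. snd (fst (s p))) \<and>
     one_form A W (\<lambda>p. fst (snd (s p))) \<and> smooth_fun A W (\<lambda>p. snd (snd (s p)))"

(* A rank k sub-bundle, given by its fibres: locally spanned by a frame of k smooth sections. *)
definition E1_subbundle ::
    "('a::topological_space, 'e::euclidean_space) chart set \<Rightarrow> nat
      \<Rightarrow> ('a \<Rightarrow> ('a, 'e) E1vec set) \<Rightarrow> bool" where
  "E1_subbundle A k L \<longleftrightarrow>
     (\<forall>p. \<exists>W s. open W \<and> p \<in> W \<and> (\<forall>i<k. E1_section A W (s i)) \<and>
        (\<forall>q\<in>W. inj_on (\<lambda>i. s i q) {..<k} \<and> independent ((\<lambda>i. s i q) ` {..<k}) \<and>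
               L q = span ((\<lambda>i. s i q) ` {..<k})))"

(* the fibres of L\<^sub>\<eta>; X and f range over global vector fields and functions *)
definition L_form ::
    "('a, 'e::euclidean_space) chart set \<Rightarrow> ('a \<Rightarrow> ('a, 'e) covec)
      \<Rightarrow> 'a \<Rightarrow> ('a, 'e) E1vec set" where
  "L_form A \<eta> p =
     {((X p, f p), (ext_deriv A \<eta> p (X p) + f p *\<^sub>R \<eta> p, - \<eta> p (X p))) | X f.
        vector_field A UNIV X \<and> smooth_fun A UNIV f}"

(* the fibres of (TM \<times> {0}) \<oplus> ({0} \<times> \<real>) *)
definition TM_R_subbundle ::
    "('a, 'e::euclidean_space) chart set \<Rightarrow> 'a \<Rightarrow> ('a, 'e) E1vec set" where
  "TM_R_subbundle A p = {((u, 0), (0, g)) | u g. u \<in> tangent_space A p}"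

end

theory Submission
  imports Defs
begin

text \<open>
  Fix a point and write \<open>\<omega>\<close> for \<open>d\<eta>\<close> there. An element of \<open>L\<^sub>\<eta>\<close> that lies in
  \<open>(TM \<times> {0}) \<oplus> ({0} \<times> \<real>)\<close> has the form \<open>(u, 0) + (0, - \<eta> u)\<close> with \<open>\<omega>(u, \<sqdot>) = 0\<close>; conversely every
  such \<open>u\<close> occurs, because a tangent vector extends to a global vector field with the help of a bump
  function (\<open>tangent_vector_extends\<close>, \<open>L_form_Int_TM_R\<close>). So the fibre is spanned by
  \<open>(\<xi>, 0) + (0, -1)\<close> exactly if \<open>\<eta> \<xi> = 1\<close> and the kernel of \<open>\<omega>\<close> is the line through \<open>\<xi>\<close>: the vector
  \<open>\<xi>\<close> is the Reeb vector. What remains is the claim that \<open>\<eta> \<and> \<omega>\<^sup>n \<noteq> 0\<close> is equivalent to the existence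
  of a Reeb vector, and that the Reeb vectors of a contact form are a smooth field.

  Both directions rest on one description of the top form. Collapsing the nested permutation sums,
  \<open>\<eta> \<and> \<omega>\<^sup>n\<close> is, up to a nonzero constant, the antisymmetrization \<open>H\<close> of
  \<open>\<eta>(v\<^sub>0) \<omega>(v\<^sub>1, v\<^sub>2) \<dots>\<close> (\<open>wedge_lead_power\<close>), and \<open>\<omega>\<^sup>n\<^sup>+\<^sup>1\<close> satisfies
  \<open>\<omega>\<^sup>n\<^sup>+\<^sup>1(x, v\<^sub>0, v\<^sub>1, \<dots>) = const \<sqdot> (\<omega>(x, \<sqdot>) \<and> \<omega>\<^sup>n)(v\<^sub>0, v\<^sub>1, \<dots>)\<close>
  (\<open>alternation_pair_product_expand\<close>).

  If \<open>H\<close> is nonzero, it is nonzero on the standard basis \<open>b\<close>. Grouping the permutations \<open>\<sigma>\<close> by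
  \<open>\<sigma> 0\<close> writes \<open>H(b)\<close> as \<open>\<Sum>\<^sub>k \<eta>(b\<^sub>k) Q\<^sub>k\<close>, where \<open>Q\<^sub>k\<close> is polynomial in the coefficients of
  \<open>\<omega>\<close>. Then \<open>\<xi> = \<Sum>\<^sub>k (Q\<^sub>k / H(b)) b\<^sub>k\<close> has \<open>\<eta> \<xi> = 1\<close>; and \<open>\<omega>(b\<^sub>j, \<xi>)\<close> is a multiple of
  \<open>\<omega>\<^sup>n\<^sup>+\<^sup>1(b\<^sub>j, b\<^sub>0, b\<^sub>1, \<dots>)\<close>, which vanishes because \<open>b\<^sub>j\<close> is repeated. A vector annihilated by
  both \<open>\<eta>\<close> and \<open>\<omega>\<close> is zero, for putting it into one slot of \<open>H(b)\<close> gives zero. Hence \<open>\<xi>\<close> is the Reeb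
  vector (\<open>reeb_vector\<close>), and the explicit formula shows that it is smooth. Here \<open>d\<eta>\<close> has to be
  computed in a chart that stays fixed while the point moves, which needs the coordinate formula for
  \<open>d\<eta>\<close> to be independent of the chart; this is the symmetry of second derivatives
  (\<open>chart_ext_deriv_change_chart\<close>).

  Conversely, if there is a Reeb vector, \<open>\<omega>\<close> is nondegenerate on the kernel of \<open>\<eta>\<close>. Splitting off
  hyperbolic planes gives vectors on which \<open>\<omega>\<^sup>n\<close> does not vanish
  (\<open>nondegenerate_pair_product\<close>), and \<open>\<eta> \<and> \<omega>\<^sup>n\<close> does not vanish on these vectors together with
  \<open>\<xi>\<close>.
\<close>

section \<open>Antisymmetrized products\<close>

definition alternation :: "nat \<Rightarrow> ((nat \<Rightarrow> 'v) \<Rightarrow> real) \<Rightarrow> (nat \<Rightarrow> 'v) \<Rightarrow> real" where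
  "alternation l \<beta> v = (\<Sum>\<sigma> | \<sigma> permutes {..<l}. of_int (sign \<sigma>) * \<beta> (\<lambda>i. v (\<sigma> i)))"

text \<open>The power \<open>\<omega>\<^sup>m\<close> of a 2-form before antisymmetrization.\<close>

definition pair_product :: "nat \<Rightarrow> ('v \<Rightarrow> 'v \<Rightarrow> real) \<Rightarrow> (nat \<Rightarrow> 'v) \<Rightarrow> real" where
  "pair_product m \<omega> v = (\<Prod>i<m. \<omega> (v (2 * i)) (v (2 * i + 1)))"

text \<open>The product \<open>\<alpha> \<and> \<omega>\<^sup>m\<close> of a 1-form with the power of a 2-form before antisymmetrization.\<close>

definition lead_pair_product ::
    "nat \<Rightarrow> ('v \<Rightarrow> real) \<Rightarrow> ('v \<Rightarrow> 'v \<Rightarrow> real) \<Rightarrow> (nat \<Rightarrow> 'v) \<Rightarrow> real" where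
  "lead_pair_product m \<alpha> \<omega> v = \<alpha> (v 0) * pair_product m \<omega> (\<lambda>i. v (Suc i))"

lemma alternation_permute:
  assumes "\<tau> permutes {..<l}"
  shows "alternation l \<beta> (\<lambda>i. v (\<tau> i)) = of_int (sign \<tau>) * alternation l \<beta> v"
proof -
  have "alternation l \<beta> v
      = (\<Sum>\<sigma> | \<sigma> permutes {..<l}. of_int (sign (\<tau> \<circ> \<sigma>)) * \<beta> (\<lambda>i. v ((\<tau> \<circ> \<sigma>) i)))"
    unfolding alternation_def by (rule setum_permutations_compose_left[OF assms])
  also have "\<dots> = (\<Sum>\<sigma> | \<sigma> permutes {..<l}.
      of_int (sign \<tau>) * (of_int (sign \<sigma>) * \<beta> (\<lambda>i. v (\<tau> (\<sigma> i)))))"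
    using assms by (intro sum.cong) (auto simp: sign_compose permutes_imp_permutation[of "{..<l}"])
  also have "\<dots> = of_int (sign \<tau>) * alternation l \<beta> (\<lambda>i. v (\<tau> i))"
    by (simp add: alternation_def sum_distrib_left)
  finally have "of_int (sign \<tau>) * alternation l \<beta> v
      = of_int (sign \<tau> * sign \<tau>) * alternation l \<beta> (\<lambda>i. v (\<tau> i))"
    by (simp only: of_int_mult mult.assoc)
  then show ?thesis by simp
qed

lemma alternation_repeated:
  assumes "i < l" "j < l" "i \<noteq> j" "v i = v j"
  shows "alternation l \<beta> v = 0"
proof -
  have "v (Transposition.transpose i j k) = v k" for k
    using assms(4) by (auto simp: Transposition.transpose_def)
  then have "alternation l \<beta> v = alternation l \<beta> (\<lambda>k. v (Transposition.transpose i j k))" by simp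
  also have "\<dots> = - alternation l \<beta> v"
    using alternation_permute[OF permutes_swap_id[of i "{..<l}" j], of \<beta> v] assms
    by (simp add: sign_swap_id)
  finally show ?thesis by simp
qed

text \<open>Permutations of \<open>{..<l}\<close> are made to act on the last \<open>l\<close> of \<open>k + l\<close> places.\<close>

lemma map_permutation_shift:
  fixes k l :: nat
  assumes "\<tau> permutes {..<l}"
  defines "\<rho> \<equiv> map_permutation {..<l} ((+) k) \<tau>"
  shows "\<rho> permutes {k..<k + l}" "sign \<rho> = sign \<tau>"
    and "i < l \<Longrightarrow> \<rho> (k + i) = k + \<tau> i" "i < k \<Longrightarrow> \<rho> i = i"
proof -
  have im: "(+) k ` {..<l} = {k..<k + l}"
    using image_add_atLeastLessThan[of k 0 l] unfolding lessThan_atLeast0 add_0 by (simp only: add.commute)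
  have "bij_betw ((+) k) {..<l} {k..<k + l}"
    by (simp add: bij_betw_def im)
  then show p: "\<rho> permutes {k..<k + l}"
    unfolding \<rho>_def by (rule map_permutation_permutes[OF _ assms(1)])
  show "sign \<rho> = sign \<tau>"
    unfolding \<rho>_def by (rule sign_map_permutation) (use assms in auto)
  show "i < l \<Longrightarrow> \<rho> (k + i) = k + \<tau> i"
    unfolding \<rho>_def by (simp add: map_permutation_apply)
  show "i < k \<Longrightarrow> \<rho> i = i"
    by (rule permutes_not_in[OF p]) auto
qed

text \<open>If all arguments are antisymmetrized anyway, antisymmetrizing a block of them first only multiplies
  the result by the number of permutations of the block: each of these can be absorbed into the outer
  permutation by a change of variables, and its sign cancels. This collapses the nested sums of
  iterated wedge products.\<close>

lemma alternation_absorb: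
  assumes \<alpha>: "\<And>v w. (\<And>i. i < k \<Longrightarrow> v i = w i) \<Longrightarrow> \<alpha> v = \<alpha> w"
    and \<beta>: "\<And>v w. (\<And>i. i < l \<Longrightarrow> v i = w i) \<Longrightarrow> \<beta> v = \<beta> w"
  shows "alternation (k + l) (\<lambda>v. \<alpha> v * alternation l \<beta> (\<lambda>i. v (k + i))) v
    = fact l * alternation (k + l) (\<lambda>v. \<alpha> v * \<beta> (\<lambda>i. v (k + i))) v"
proof -
  let ?S = "{\<sigma>. \<sigma> permutes {..<k + l}}" and ?T = "{\<tau>. \<tau> permutes {..<l}}"
  let ?g = "\<lambda>\<sigma>. of_int (sign \<sigma>) * (\<alpha> (\<lambda>i. v (\<sigma> i)) * \<beta> (\<lambda>i. v (\<sigma> (k + i)))) :: real"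
  \<comment> \<open>For fixed \<open>\<tau>\<close>, substitute \<open>\<sigma> \<circ> \<rho>\<close> for \<open>\<sigma>\<close>, where \<open>\<rho>\<close> is \<open>\<tau>\<close> acting on the last \<open>l\<close> places.\<close>
  have one: "(\<Sum>\<sigma>\<in>?S. of_int (sign \<sigma>) * (\<alpha> (\<lambda>i. v (\<sigma> i)) *
      (of_int (sign \<tau>) * \<beta> (\<lambda>i. v (\<sigma> (k + \<tau> i)))))) = sum ?g ?S" if \<tau>: "\<tau> \<in> ?T" for \<tau>
  proof -
    define \<rho> where "\<rho> = map_permutation {..<l} ((+) k) \<tau>"
    note \<rho> = map_permutation_shift[where \<tau> = \<tau> and l = l and k = k, folded \<rho>_def]
    have p: "\<rho> permutes {..<k + l}"
      using \<rho>(1) \<tau> by (auto elim: permutes_subset)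
    have "sum ?g ?S = (\<Sum>\<sigma>\<in>?S. ?g (\<sigma> \<circ> \<rho>))"
      by (rule sum_permutations_compose_right[OF p])
    also have "\<dots> = (\<Sum>\<sigma>\<in>?S. of_int (sign \<sigma>) * (\<alpha> (\<lambda>i. v (\<sigma> i)) *
      (of_int (sign \<tau>) * \<beta> (\<lambda>i. v (\<sigma> (k + \<tau> i))))))"
    proof (rule sum.cong[OF refl])
      fix \<sigma> assume \<sigma>: "\<sigma> \<in> ?S"
      have s: "sign (\<sigma> \<circ> \<rho>) = sign \<sigma> * sign \<tau>"
        using \<sigma> p \<rho>(2) \<tau> by (auto simp: sign_compose permutes_imp_permutation[of "{..<k+l}"])
      have a: "\<alpha> (\<lambda>i. v ((\<sigma> \<circ> \<rho>) i)) = \<alpha> (\<lambda>i. v (\<sigma> i))"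
        using \<rho>(4) \<tau> by (intro \<alpha>) auto
      have b: "\<beta> (\<lambda>i. v ((\<sigma> \<circ> \<rho>) (k + i))) = \<beta> (\<lambda>i. v (\<sigma> (k + \<tau> i)))"
        using \<rho>(3) \<tau> by (intro \<beta>) auto
      show "?g (\<sigma> \<circ> \<rho>) = of_int (sign \<sigma>) * (\<alpha> (\<lambda>i. v (\<sigma> i)) *
        (of_int (sign \<tau>) * \<beta> (\<lambda>i. v (\<sigma> (k + \<tau> i)))))"
        unfolding s a b by simp
    qed
    finally show ?thesis ..
  qed
  have "alternation (k + l) (\<lambda>v. \<alpha> v * alternation l \<beta> (\<lambda>i. v (k + i))) v
      = (\<Sum>\<sigma>\<in>?S. \<Sum>\<tau>\<in>?T. of_int (sign \<sigma>) * (\<alpha> (\<lambda>i. v (\<sigma> i)) *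
          (of_int (sign \<tau>) * \<beta> (\<lambda>i. v (\<sigma> (k + \<tau> i))))))"
    by (simp add: alternation_def sum_distrib_left)
  also have "\<dots> = (\<Sum>\<tau>\<in>?T. \<Sum>\<sigma>\<in>?S. of_int (sign \<sigma>) * (\<alpha> (\<lambda>i. v (\<sigma> i)) *
          (of_int (sign \<tau>) * \<beta> (\<lambda>i. v (\<sigma> (k + \<tau> i))))))"
    by (rule sum.swap)
  also have "\<dots> = (\<Sum>\<tau>\<in>?T. sum ?g ?S)"
    by (intro sum.cong refl one)
  also have "\<dots> = fact l * sum ?g ?S"
    by (simp add: card_permutations[of "{..<l}" l])
  finally show ?thesis by (simp add: alternation_def)
qed

lemma alternation_scale: "alternation l (\<lambda>v. a * \<beta> v) v = a * alternation l \<beta> v"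
  by (simp add: alternation_def sum_distrib_left mult.left_commute)

lemma wedge_conv_alternation:
  "wedge k l \<alpha> \<beta> v = alternation (k + l) (\<lambda>v. \<alpha> v * \<beta> (\<lambda>i. v (k + i))) v / (fact k * fact l)"
  by (simp add: wedge_def alternation_def mult.assoc)

lemma pair_product_cong:
  "(\<And>i. i < 2 * m \<Longrightarrow> v i = w i) \<Longrightarrow> pair_product m \<omega> v = pair_product m \<omega> w"
  unfolding pair_product_def by (intro prod.cong) auto

lemma pair_product_Suc:
  "pair_product (Suc m) \<omega> v = \<omega> (v 0) (v 1) * pair_product m \<omega> (\<lambda>i. v (2 + i))"
  unfolding pair_product_def by (subst prod.lessThan_Suc_shift) simp

text \<open>The factors \<open>1 / (k! l!)\<close> of the wedge product cancel the factorials from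
  \<open>alternation_absorb\<close> except for a factor \<open>1 / 2!\<close> for each copy of \<open>\<omega>\<close>.\<close>

lemma wedge_power_two:
  "wedge_power 2 (\<lambda>v. \<omega> (v 0) (v 1)) m
    = (\<lambda>v. alternation (2 * m) (pair_product m \<omega>) v / 2 ^ m)"
proof (induction m)
  case 0
  have "{\<sigma> :: nat \<Rightarrow> nat. \<sigma> permutes {..<0}} = {id}" by auto
  then show ?case by (simp add: alternation_def pair_product_def)
next
  case (Suc m)
  let ?P = "\<lambda>m. alternation (2 * m) (pair_product m \<omega>)"
  show ?case
  proof
    fix v :: "nat \<Rightarrow> 'a"
    have "wedge_power 2 (\<lambda>v. \<omega> (v 0) (v 1)) (Suc m) v
        = alternation (2 + 2 * m) (\<lambda>v. (1 / 2 ^ m) * (\<omega> (v 0) (v 1) * ?P m (\<lambda>i. v (2 + i)))) v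
          / (fact 2 * fact (2 * m))"
      unfolding wedge_power.simps wedge_conv_alternation Suc.IH by (simp add: mult.left_commute)
    also have "\<dots> = (1 / 2 ^ m) * (fact (2 * m) *
        alternation (2 + 2 * m) (\<lambda>v. \<omega> (v 0) (v 1) * pair_product m \<omega> (\<lambda>i. v (2 + i))) v)
          / (fact 2 * fact (2 * m))"
      unfolding alternation_scale
      by (subst alternation_absorb[where \<alpha> = "\<lambda>v. \<omega> (v 0) (v 1)"]) (auto intro: pair_product_cong)
    also have "\<dots> = ?P (Suc m) v / 2 ^ Suc m"
      by (simp add: pair_product_Suc[abs_def] fact_2)
    finally show "wedge_power 2 (\<lambda>v. \<omega> (v 0) (v 1)) (Suc m) v = ?P (Suc m) v / 2 ^ Suc m" .
  qed
qed

lemma wedge_lead_power: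
  "wedge 1 (2 * n) (\<lambda>v. \<alpha> (v 0)) (wedge_power 2 (\<lambda>v. \<omega> (v 0) (v 1)) n) v
    = alternation (2 * n + 1) (lead_pair_product n \<alpha> \<omega>) v / 2 ^ n"
proof -
  have "wedge 1 (2 * n) (\<lambda>v. \<alpha> (v 0)) (wedge_power 2 (\<lambda>v. \<omega> (v 0) (v 1)) n) v
    = alternation (1 + 2 * n) (\<lambda>v. (1 / 2 ^ n) *
        (\<alpha> (v 0) * alternation (2 * n) (pair_product n \<omega>) (\<lambda>i. v (1 + i)))) v / fact (2 * n)"
    unfolding wedge_power_two wedge_conv_alternation by (simp add: mult.left_commute)
  also have "\<dots> = (1 / 2 ^ n) * (fact (2 * n) *
      alternation (1 + 2 * n) (\<lambda>v. \<alpha> (v 0) * pair_product n \<omega> (\<lambda>i. v (1 + i))) v) / fact (2 * n)"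
    unfolding alternation_scale
    by (subst alternation_absorb[where \<alpha> = "\<lambda>v. \<alpha> (v 0)"]) (auto intro: pair_product_cong)
  finally show ?thesis by (simp add: lead_pair_product_def[abs_def])
qed

text \<open>The permutations of \<open>{..<Suc l}\<close> that fix 0 are the permutations of the other \<open>l\<close> places. Hence
  this part of an antisymmetrization is an antisymmetrization in one argument less.\<close>

lemma alternation_fixing_zero:
  assumes \<beta>: "\<And>v w. (\<And>i. i < Suc l \<Longrightarrow> v i = w i) \<Longrightarrow> \<beta> v = \<beta> w"
  shows "(\<Sum>\<sigma> | \<sigma> permutes {..<Suc l} \<and> \<sigma> 0 = 0. of_int (sign \<sigma>) * \<beta> (\<lambda>i. v (\<sigma> i)))
    = alternation l (\<lambda>w. \<beta> (case_nat (v 0) w)) (\<lambda>i. v (Suc i))"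
proof -
  have perms: "{\<sigma>. \<sigma> permutes {..<Suc l} \<and> \<sigma> 0 = 0} = {\<sigma>. \<sigma> permutes {1..<1 + l}}"
  proof (intro set_eqI iffI; clarsimp)
    fix \<sigma> assume \<sigma>: "\<sigma> permutes {..<Suc l}" "\<sigma> 0 = 0"
    have "\<sigma> x = x" if "x \<in> {..<Suc l} - {Suc 0..<Suc l}" for x
      using that \<sigma>(2) by (cases x) auto
    then show "\<sigma> permutes {Suc 0..<Suc l}"
      by (intro permutes_superset[OF \<sigma>(1)]) auto
  next
    fix \<sigma> assume \<sigma>: "\<sigma> permutes {Suc 0..<Suc l}"
    show "\<sigma> permutes {..<Suc l} \<and> \<sigma> 0 = 0"
      using permutes_subset[OF \<sigma>, of "{..<Suc l}"] permutes_not_in[OF \<sigma>, of 0]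
      by (auto simp: subset_iff)
  qed
  let ?m = "map_permutation {..<l} ((+) 1)"
  have im: "(+) 1 ` {..<l} = {1..<1 + l}"
    using image_add_atLeastLessThan[of 1 0 l] unfolding lessThan_atLeast0 add_0 by (simp only: add.commute)
  have bb: "bij_betw ((+) 1) {..<l} {1..<1 + l}"
    unfolding bij_betw_def im by simp
  have bij: "bij_betw ?m {\<tau>. \<tau> permutes {..<l}} {\<sigma>. \<sigma> permutes {1..<1 + l}}"
    using bij_betw_permutations[OF bb] unfolding map_permutation_def restrict_id_def im o_def .
  have "(\<Sum>\<sigma> | \<sigma> permutes {1..<1 + l}. of_int (sign \<sigma>) * \<beta> (\<lambda>i. v (\<sigma> i)))
     = (\<Sum>\<tau> | \<tau> permutes {..<l}. of_int (sign (?m \<tau>)) * \<beta> (\<lambda>i. v (?m \<tau> i)))"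
    by (rule sum.reindex_bij_betw[OF bij, symmetric])
  also have "\<dots> = alternation l (\<lambda>w. \<beta> (case_nat (v 0) w)) (\<lambda>i. v (Suc i))"
    unfolding alternation_def
  proof (rule sum.cong[OF refl])
    fix \<tau> assume "\<tau> \<in> {\<tau>. \<tau> permutes {..<l}}"
    then have \<tau>: "\<tau> permutes {..<l}" by simp
    note \<rho> = map_permutation_shift[OF \<tau>, where k = 1]
    have "\<beta> (\<lambda>i. v (?m \<tau> i)) = \<beta> (case_nat (v 0) (\<lambda>i. v (Suc (\<tau> i))))"
    proof (rule \<beta>)
      fix i assume "i < Suc l"
      then show "v (?m \<tau> i) = case_nat (v 0) (\<lambda>i. v (Suc (\<tau> i))) i"
        using \<rho>(3)[of "i - 1"] \<rho>(4)[of 0] by (cases i) auto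
    qed
    then show "of_int (sign (?m \<tau>)) * \<beta> (\<lambda>i. v (?m \<tau> i))
      = of_int (sign \<tau>) * \<beta> (case_nat (v 0) (\<lambda>i. v (Suc (\<tau> i))))"
      by (simp only: \<rho>(2))
  qed
  finally show ?thesis unfolding perms .
qed

section \<open>Expansion of the powers of a 2-form\<close>

text \<open>If \<open>\<alpha>\<close> sees only the first vector, then only the permutations fixing 0 contribute to
  \<open>\<alpha> \<and> \<omega>\<^sup>m\<close>.\<close>

lemma alternation_lead_pair_product_fixed:
  assumes "\<And>i. i < 2 * m \<Longrightarrow> \<alpha> (v (Suc i)) = 0"
  shows "alternation (2 * m + 1) (lead_pair_product m \<alpha> \<omega>) v
    = \<alpha> (v 0) * alternation (2 * m) (pair_product m \<omega>) (\<lambda>i. v (Suc i))"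
proof -
  let ?h = "\<lambda>\<sigma>. of_int (sign \<sigma>) * lead_pair_product m \<alpha> \<omega> (\<lambda>i. v (\<sigma> i))"
  have "alternation (2 * m + 1) (lead_pair_product m \<alpha> \<omega>) v
      = sum ?h {\<sigma>. \<sigma> permutes {..<Suc (2 * m)} \<and> \<sigma> 0 = 0}"
    unfolding alternation_def
  proof (rule sum.mono_neutral_right)
    show "\<forall>\<sigma> \<in> {\<sigma>. \<sigma> permutes {..<2 * m + 1}}
        - {\<sigma>. \<sigma> permutes {..<Suc (2 * m)} \<and> \<sigma> 0 = 0}. ?h \<sigma> = 0"
    proof
      fix \<sigma> assume "\<sigma> \<in> {\<sigma>. \<sigma> permutes {..<2 * m + 1}}
        - {\<sigma>. \<sigma> permutes {..<Suc (2 * m)} \<and> \<sigma> 0 = 0}"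
      then have \<sigma>: "\<sigma> permutes {..<Suc (2 * m)}" "\<sigma> 0 \<noteq> 0" by auto
      then obtain i where "\<sigma> 0 = Suc i" "i < 2 * m"
        using permutes_in_image[OF \<sigma>(1), of 0] by (cases "\<sigma> 0") auto
      then show "?h \<sigma> = 0" by (simp add: lead_pair_product_def assms)
    qed
  qed (auto simp: finite_permutations)
  also have "\<dots> = alternation (2 * m) (\<lambda>w. lead_pair_product m \<alpha> \<omega> (case_nat (v 0) w)) (\<lambda>i. v (Suc i))"
    by (rule alternation_fixing_zero)
      (auto simp: lead_pair_product_def intro!: arg_cong2[where f = "(*)"] pair_product_cong)
  also have "\<dots> = \<alpha> (v 0) * alternation (2 * m) (pair_product m \<omega>) (\<lambda>i. v (Suc i))"
    by (simp add: lead_pair_product_def alternation_scale)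
  finally show ?thesis .
qed

text \<open>The antisymmetrization of \<open>\<omega>(v\<^sub>0, v\<^sub>1) \<omega>(v\<^sub>2, v\<^sub>3) \<dots>\<close> treats all places alike: the place \<open>k\<close> is
  moved to the front by exchanging its pair with the first pair, an even permutation that only
  reorders the factors, and, if \<open>k\<close> is odd, by the swap inside the pair, which \<open>\<omega>\<close> answers with the
  sign of the swap.\<close>

lemma pair_product_bring_to_front:
  assumes anti: "\<And>x y. \<omega> x y = - \<omega> y x" and k: "k < 2 * Suc m"
  obtains \<rho> where "\<rho> permutes {..<2 * Suc m}" "\<rho> 0 = k"
    "\<And>w. pair_product (Suc m) \<omega> (\<lambda>i. w (\<rho> i)) = of_int (sign \<rho>) * pair_product (Suc m) \<omega> w"
proof -
  define i where "i = k div 2"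
  have i: "i < Suc m" using k by (auto simp: i_def)
  \<comment> \<open>exchanges the pair with index \<open>i\<close> and the one with index 0\<close>
  define \<rho> :: "nat \<Rightarrow> nat"
    where "\<rho> = Transposition.transpose 0 (2 * i) \<circ> Transposition.transpose 1 (2 * i + 1)"
  have p: "\<rho> permutes {..<2 * Suc m}"
    unfolding \<rho>_def by (intro permutes_compose permutes_swap_id) (use i in auto)
  have "sign \<rho> = sign (Transposition.transpose 0 (2 * i)) * sign (Transposition.transpose 1 (2 * i + 1))"
    unfolding \<rho>_def by (intro sign_compose permutation_swap_id)
  then have s: "sign \<rho> = 1" by (auto simp: sign_swap_id)
  have pairs: "\<rho> (2 * j) = 2 * Transposition.transpose 0 i j"
    "\<rho> (Suc (2 * j)) = Suc (2 * Transposition.transpose 0 i j)" for j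
    by (auto simp: \<rho>_def Transposition.transpose_def) presburger+
  have pp: "pair_product (Suc m) \<omega> (\<lambda>i. w (\<rho> i)) = pair_product (Suc m) \<omega> w" for w
  proof -
    let ?t = "Transposition.transpose 0 i" and ?g = "\<lambda>j. \<omega> (w (2 * j)) (w (2 * j + 1))"
    have "?t permutes {..<Suc m}" using i by (intro permutes_swap_id) auto
    then have "prod ?g {..<Suc m} = prod (?g \<circ> ?t) {..<Suc m}" by (rule prod.permute)
    then show ?thesis by (simp add: pair_product_def pairs)
  qed
  show thesis
  proof (cases "even k")
    case True
    then have "\<rho> 0 = k" using pairs(1)[of 0] by (simp add: i_def)
    with p s pp show ?thesis by (intro that[of \<rho>]) auto
  next
    case False
    let ?s = "Transposition.transpose 0 (1 :: nat)"
    have ps: "?s permutes {..<2 * Suc m}" by (intro permutes_swap_id) auto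
    have "(\<rho> \<circ> ?s) 0 = k"
      using False pairs(2)[of 0] by (simp add: i_def)
    moreover have "sign (\<rho> \<circ> ?s) = -1"
      using s sign_compose[of \<rho> ?s] permutes_imp_permutation[OF _ p]
      by (simp add: permutation_swap_id sign_swap_id)
    moreover have "pair_product (Suc m) \<omega> (\<lambda>i. w ((\<rho> \<circ> ?s) i)) = - pair_product (Suc m) \<omega> w" for w
    proof -
      have "pair_product (Suc m) \<omega> (\<lambda>i. w ((\<rho> \<circ> ?s) i))
          = \<omega> (w (\<rho> 1)) (w (\<rho> 0)) * pair_product m \<omega> (\<lambda>i. w (\<rho> (2 + i)))"
        by (simp add: pair_product_Suc Transposition.transpose_def)
      also have "\<dots> = - pair_product (Suc m) \<omega> (\<lambda>i. w (\<rho> i))"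
        by (subst anti) (simp add: pair_product_Suc)
      finally show ?thesis by (simp add: pp)
    qed
    ultimately show ?thesis
      using permutes_compose[OF ps p] by (intro that[of "\<rho> \<circ> ?s"]) auto
  qed
qed

text \<open>The identity \<open>\<iota>\<^sub>x \<omega>\<^sup>m\<^sup>+\<^sup>1 = (m + 1) \<omega>(x, \<sqdot>) \<and> \<omega>\<^sup>m\<close> in terms of permutation sums: the permutations
  are grouped by the place at which \<open>v\<^sub>0\<close> appears, and by \<open>pair_product_bring_to_front\<close> all the
  \<open>2 (m + 1)\<close> groups contribute the same as the one with \<open>v\<^sub>0\<close> in front.\<close>

lemma alternation_pair_product_expand:
  assumes anti: "\<And>x y. \<omega> x y = - \<omega> y x"
  shows "alternation (2 * Suc m) (pair_product (Suc m) \<omega>) v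
    = 2 * real (Suc m) *
      alternation (2 * m + 1) (lead_pair_product m (\<omega> (v 0)) \<omega>) (\<lambda>i. v (Suc i))"
proof -
  let ?S = "{\<sigma>. \<sigma> permutes {..<2 * Suc m}}"
  let ?h = "\<lambda>\<sigma>. of_int (sign \<sigma>) * pair_product (Suc m) \<omega> (\<lambda>i. v (\<sigma> i)) :: real"
  have move: "sum ?h {\<sigma>\<in>?S. inv \<sigma> 0 = k} = sum ?h {\<sigma>\<in>?S. \<sigma> 0 = 0}" if k: "k < 2 * Suc m" for k
  proof -
    obtain \<rho> where \<rho>: "\<rho> permutes {..<2 * Suc m}" "\<rho> 0 = k"
      "\<And>w. pair_product (Suc m) \<omega> (\<lambda>i. w (\<rho> i)) = of_int (sign \<rho>) * pair_product (Suc m) \<omega> w"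
      by (rule pair_product_bring_to_front[of \<omega>, OF anti k]) (rule that)
    have h: "?h (\<sigma> \<circ> \<rho>) = ?h \<sigma>" if "\<sigma> \<in> ?S" for \<sigma>
    proof -
      have "sign (\<sigma> \<circ> \<rho>) = sign \<sigma> * sign \<rho>"
        using that \<rho>(1) by (auto simp: sign_compose permutes_imp_permutation[of "{..<2 * Suc m}"])
      moreover have "real_of_int (sign \<rho>) * real_of_int (sign \<rho>) = 1"
        by (metis of_int_1 of_int_mult sign_idempotent)
      ultimately show ?thesis using \<rho>(3)[of "\<lambda>i. v (\<sigma> i)"] by simp
    qed
    show ?thesis
    proof (rule sum.reindex_bij_witness[of _ "\<lambda>\<sigma>. \<sigma> \<circ> inv \<rho>" "\<lambda>\<sigma>. \<sigma> \<circ> \<rho>"])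
      fix \<sigma> assume a: "\<sigma> \<in> {\<sigma>\<in>?S. inv \<sigma> 0 = k}"
      then have \<sigma>: "\<sigma> permutes {..<2 * Suc m}" by simp
      show "\<sigma> \<circ> \<rho> \<circ> inv \<rho> = \<sigma>"
        using permutes_inv_o(1)[OF \<rho>(1)] by (simp add: comp_assoc)
      show "\<sigma> \<circ> \<rho> \<in> {\<sigma>\<in>?S. \<sigma> 0 = 0}"
        using a \<rho>(2) permutes_compose[OF \<rho>(1) \<sigma>] permutes_inverses(1)[OF \<sigma>, of 0] by auto
      show "?h (\<sigma> \<circ> \<rho>) = ?h \<sigma>" using h a by simp
    next
      fix \<sigma> assume a: "\<sigma> \<in> {\<sigma>\<in>?S. \<sigma> 0 = 0}"
      then have \<sigma>: "\<sigma> permutes {..<2 * Suc m}" by simp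
      have q: "\<sigma> \<circ> inv \<rho> permutes {..<2 * Suc m}"
        by (rule permutes_compose[OF permutes_inv[OF \<rho>(1)] \<sigma>])
      show "\<sigma> \<circ> inv \<rho> \<circ> \<rho> = \<sigma>"
        using permutes_inv_o(2)[OF \<rho>(1)] by (simp add: comp_assoc)
      have "(\<sigma> \<circ> inv \<rho>) k = 0"
        using a \<rho>(2) permutes_inverses(2)[OF \<rho>(1), of 0] by auto
      then have "inv (\<sigma> \<circ> inv \<rho>) 0 = k"
        using permutes_inv_eq[OF q] by simp
      then show "\<sigma> \<circ> inv \<rho> \<in> {\<sigma>\<in>?S. inv \<sigma> 0 = k}" using q by simp
    qed
  qed
  have "alternation (2 * Suc m) (pair_product (Suc m) \<omega>) v = sum ?h ?S"
    by (simp add: alternation_def)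
  also have "\<dots> = (\<Sum>k<2 * Suc m. sum ?h {\<sigma>\<in>?S. inv \<sigma> 0 = k})"
  proof (rule sum.group[symmetric])
    show "(\<lambda>\<sigma>. inv \<sigma> 0) ` ?S \<subseteq> {..<2 * Suc m}"
      using permutes_in_image[OF permutes_inv, of _ "{..<2 * Suc m}" 0] by auto
  qed (auto simp: finite_permutations)
  also have "\<dots> = 2 * real (Suc m) * sum ?h {\<sigma>\<in>?S. \<sigma> 0 = 0}"
    by (subst sum.cong[OF refl move]) auto
  also have "{\<sigma>\<in>?S. \<sigma> 0 = 0} = {\<sigma>. \<sigma> permutes {..<Suc (2 * m + 1)} \<and> \<sigma> 0 = 0}"
    by simp
  also have "sum ?h \<dots>
    = alternation (2 * m + 1) (\<lambda>w. pair_product (Suc m) \<omega> (case_nat (v 0) w)) (\<lambda>i. v (Suc i))"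
    by (rule alternation_fixing_zero) (auto intro: pair_product_cong)
  also have "(\<lambda>w. pair_product (Suc m) \<omega> (case_nat (v 0) w)) = lead_pair_product m (\<omega> (v 0)) \<omega>"
    by (simp add: fun_eq_iff pair_product_Suc lead_pair_product_def)
  finally show ?thesis .
qed

text \<open>Up to a factor this is \<open>\<omega>\<^sup>n\<^sup>+\<^sup>1\<close> evaluated at \<open>b\<^sub>j, b\<^sub>0, \<dots>, b\<^sub>2\<^sub>n\<close>, where \<open>b\<^sub>j\<close> occurs twice.\<close>

lemma alternation_lead_contracted:
  fixes b :: "nat \<Rightarrow> 'v"
  assumes anti: "\<And>x y. \<omega> x y = - \<omega> y x" and j: "j < 2 * n + 1"
  shows "alternation (2 * n + 1) (lead_pair_product n (\<omega> (b j)) \<omega>) b = 0"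
  using alternation_pair_product_expand[of \<omega>, OF anti, where m = n and v = "case_nat (b j) b"] j
    alternation_repeated[where i = 0 and l = "2 * Suc n" and j = "Suc j" and v = "case_nat (b j) b"
      and \<beta> = "pair_product (Suc n) \<omega>"]
  by simp

text \<open>Up to a common factor, the coordinates of the Reeb vector \<open>\<xi>\<close> in the basis \<open>b\<close>. From
  \<open>\<eta> \<xi> = 1\<close> and \<open>\<omega>(\<xi>, \<sqdot>) = 0\<close> follows \<open>\<iota>\<^sub>\<xi> (\<eta> \<and> \<omega>\<^sup>n) = \<omega>\<^sup>n\<close>, so the \<open>k\<close>-th coordinate is determined by
  the value of \<open>\<omega>\<^sup>n\<close> on the basis vectors other than \<open>b\<^sub>k\<close>.\<close>

definition reeb_coeff :: "nat \<Rightarrow> ('v \<Rightarrow> 'v \<Rightarrow> real) \<Rightarrow> (nat \<Rightarrow> 'v) \<Rightarrow> nat \<Rightarrow> real" where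
  "reeb_coeff n \<omega> b k = (\<Sum>\<sigma> | \<sigma> permutes {..<2 * n + 1} \<and> \<sigma> 0 = k.
     of_int (sign \<sigma>) * pair_product n \<omega> (\<lambda>i. b (\<sigma> (Suc i))))"

text \<open>The permutations \<open>\<sigma>\<close> in the sum on the right are grouped by \<open>\<sigma> 0\<close>. The coefficients do not depend
  on \<open>\<alpha>\<close>, so one family of numbers serves \<open>\<alpha> = \<eta>\<close> and \<open>\<alpha> = \<omega>(b\<^sub>j, \<sqdot>)\<close>.\<close>

lemma sum_reeb_coeff:
  "(\<Sum>k<2 * n + 1. \<alpha> (b k) * reeb_coeff n \<omega> b k)
    = alternation (2 * n + 1) (lead_pair_product n \<alpha> \<omega>) b"
proof -
  let ?S = "{\<sigma>. \<sigma> permutes {..<2 * n + 1}}"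
  let ?h = "\<lambda>\<sigma>. of_int (sign \<sigma>) * lead_pair_product n \<alpha> \<omega> (\<lambda>i. b (\<sigma> i))"
  have "(\<Sum>k<2 * n + 1. \<alpha> (b k) * reeb_coeff n \<omega> b k)
      = (\<Sum>k<2 * n + 1. sum ?h {\<sigma>\<in>?S. \<sigma> 0 = k})"
    unfolding reeb_coeff_def lead_pair_product_def sum_distrib_left
    by (intro sum.cong) auto
  also have "\<dots> = sum ?h ?S"
    by (rule sum.group) (auto simp: finite_permutations dest: permutes_in_image[where x = 0])
  finally show ?thesis by (simp add: alternation_def)
qed

section \<open>The Reeb vector of a 1-form and a 2-form on a vector space\<close>

lemma lead_pair_product_cong:
  "(\<And>i. i < 2 * m + 1 \<Longrightarrow> v i = w i) \<Longrightarrow> lead_pair_product m \<alpha> \<omega> v = lead_pair_product m \<alpha> \<omega> w"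
  unfolding lead_pair_product_def by (intro arg_cong2[where f = "(*)"] pair_product_cong) auto

lemma alternation_cong:
  assumes "\<And>v w. (\<And>i. i < l \<Longrightarrow> v i = w i) \<Longrightarrow> \<beta> v = \<beta> w"
    and "\<And>i. i < l \<Longrightarrow> v i = w i"
  shows "alternation l \<beta> v = alternation l \<beta> w"
proof -
  have "\<beta> (\<lambda>i. v (\<sigma> i)) = \<beta> (\<lambda>i. w (\<sigma> i))" if "\<sigma> permutes {..<l}" for \<sigma>
    using permutes_in_image[OF that] by (intro assms) auto
  then show ?thesis unfolding alternation_def by (intro sum.cong) auto
qed

lemma linear_alternation:
  assumes lin: "\<And>v i. i < l \<Longrightarrow> linear (\<lambda>x. \<beta> (v(i := x)))" and i: "i < l"
  shows "linear (\<lambda>x. alternation l \<beta> (v(i := x)))"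
proof -
  have "linear (\<lambda>x. of_int (sign \<sigma>) * \<beta> (\<lambda>j. (v(i := x)) (\<sigma> j)))" if \<sigma>: "\<sigma> permutes {..<l}" for \<sigma>
  proof -
    have "(\<lambda>j. (v(i := x)) (\<sigma> j)) = (\<lambda>j. v (\<sigma> j))(inv \<sigma> i := x)" for x
      using permutes_inverses[OF \<sigma>] by (auto simp: fun_eq_iff)
    moreover have "inv \<sigma> i < l"
      using permutes_in_image[OF permutes_inv[OF \<sigma>], of i] i by auto
    ultimately show ?thesis
      using linear_compose_scale_right[OF lin[of "inv \<sigma> i" "\<lambda>j. v (\<sigma> j)"], of "of_int (sign \<sigma>)"] by simp
  qed
  then show ?thesis
    unfolding alternation_def by (intro linear_compose_sum) auto
qed

lemma linear_lead_pair_product: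
  assumes \<alpha>: "linear \<alpha>" and \<omega>: "bilinear \<omega>" and i: "i < 2 * m + 1"
  shows "linear (\<lambda>x. lead_pair_product m \<alpha> \<omega> (v(i := x)))"
proof (cases i)
  case 0
  then have "lead_pair_product m \<alpha> \<omega> (v(i := x)) = pair_product m \<omega> (\<lambda>i. v (Suc i)) * \<alpha> x" for x
    by (simp add: lead_pair_product_def)
  then show ?thesis using linear_compose_scale_right[OF \<alpha>] by simp
next
  case (Suc j)
  define k where "k = j div 2"
  have k: "k < m" using Suc i by (auto simp: k_def)
  let ?v = "\<lambda>x i. (v(Suc j := x)) (Suc i)"
  let ?c = "\<alpha> (v 0) * (\<Prod>i\<in>{..<m} - {k}. \<omega> (v (Suc (2 * i))) (v (Suc (2 * i + 1))))"
  have rest: "?v x (2 * i) = v (Suc (2 * i))" "?v x (2 * i + 1) = v (Suc (2 * i + 1))"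
    if "i \<noteq> k" for x i
    using that by (auto simp: k_def)
  have "lead_pair_product m \<alpha> \<omega> (v(i := x)) = ?c * \<omega> (?v x (2 * k)) (?v x (2 * k + 1))" for x
  proof -
    have "pair_product m \<omega> (?v x) = \<omega> (?v x (2 * k)) (?v x (2 * k + 1)) *
        (\<Prod>i\<in>{..<m} - {k}. \<omega> (?v x (2 * i)) (?v x (2 * i + 1)))"
      unfolding pair_product_def using k by (intro prod.remove) auto
    also have "(\<Prod>i\<in>{..<m} - {k}. \<omega> (?v x (2 * i)) (?v x (2 * i + 1)))
        = (\<Prod>i\<in>{..<m} - {k}. \<omega> (v (Suc (2 * i))) (v (Suc (2 * i + 1))))"
      by (intro prod.cong refl arg_cong2[where f = \<omega>] rest) auto
    finally show ?thesis by (simp add: Suc lead_pair_product_def)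
  qed
  moreover have "linear (\<lambda>x. \<omega> (?v x (2 * k)) (?v x (2 * k + 1)))"
  proof (cases "even j")
    case True
    then have "2 * k = j" by (simp add: k_def)
    then show ?thesis using \<omega> by (simp add: bilinear_def)
  next
    case False
    then have "2 * k + 1 = j" by (simp add: k_def)
    then have "(\<lambda>x. \<omega> (?v x (2 * k)) (?v x (2 * k + 1))) = \<omega> (v (Suc (2 * k)))" by (auto simp: fun_eq_iff)
    then show ?thesis using \<omega> by (simp add: bilinear_def)
  qed
  ultimately show ?thesis
    using linear_compose_scale_right[of "\<lambda>x. \<omega> (?v x (2 * k)) (?v x (2 * k + 1))" ?c] by simp
qed

text \<open>In dimension \<open>l\<close> an alternating \<open>l\<close>-form is determined by its value on one basis. The arguments
  are expanded in the basis one after the other; in the end, each summand has basis vectors as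
  arguments, and these are repeated or are a permutation of \<open>b\<close>.\<close>

lemma alternation_eq_0_if_basis:
  fixes b v :: "nat \<Rightarrow> 'e::euclidean_space"
  assumes cong: "\<And>v w. (\<And>i. i < l \<Longrightarrow> v i = w i) \<Longrightarrow> \<beta> v = \<beta> w"
    and lin: "\<And>v i. i < l \<Longrightarrow> linear (\<lambda>x. \<beta> (v(i := x)))"
    and b: "bij_betw b {..<l} Basis" and zero: "alternation l \<beta> b = 0"
  shows "alternation l \<beta> v = 0"
proof -
  have "\<forall>v. (\<forall>i. k \<le> i \<and> i < l \<longrightarrow> v i \<in> Basis) \<longrightarrow> alternation l \<beta> v = 0" if "k \<le> l" for k
    using that
  proof (induction k)
    case 0
    show ?case
    proof (intro allI impI)
      fix v :: "nat \<Rightarrow> 'e" assume "\<forall>i. 0 \<le> i \<and> i < l \<longrightarrow> v i \<in> Basis"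
      then have v: "v i \<in> Basis" if "i < l" for i using that by simp
      show "alternation l \<beta> v = 0"
      proof (cases "inj_on v {..<l}")
        case False
        then obtain i j where "i < l" "j < l" "i \<noteq> j" "v i = v j" by (auto simp: inj_on_def)
        then show ?thesis by (rule alternation_repeated)
      next
        case True
        define \<tau> where "\<tau> i = (if i < l then inv_into {..<l} b (v i) else i)" for i
        have \<tau>: "\<tau> i < l" "b (\<tau> i) = v i" if "i < l" for i
          using that v[OF that] b bij_betw_inv_into_right[OF b]
            bij_betwE[OF bij_betw_inv_into[OF b]] by (auto simp: \<tau>_def)
        have inj: "inj_on \<tau> {..<l}"
          by (rule inj_onI) (metis True \<tau>(2) inj_onD lessThan_iff)
        have "\<tau> ` {..<l} = {..<l}"
          by (rule endo_inj_surj[OF _ _ inj]) (use \<tau> in auto)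
        then have "\<tau> permutes {..<l}"
          using inj by (intro bij_imp_permutes) (auto simp: bij_betw_def \<tau>_def)
        then have "alternation l \<beta> (\<lambda>i. b (\<tau> i)) = 0"
          by (simp add: alternation_permute zero)
        moreover have "alternation l \<beta> (\<lambda>i. b (\<tau> i)) = alternation l \<beta> v"
          by (rule alternation_cong[OF cong]) (use \<tau> in auto)
        ultimately show ?thesis by simp
      qed
    qed
  next
    case (Suc k)
    show ?case
    proof (intro allI impI)
      fix v :: "nat \<Rightarrow> 'e" assume v: "\<forall>i. Suc k \<le> i \<and> i < l \<longrightarrow> v i \<in> Basis"
      let ?F = "\<lambda>x. alternation l \<beta> (v(k := x))"
      have F: "linear ?F" by (rule linear_alternation[OF lin]) (use Suc in auto)
      have "?F (v k) = ?F (\<Sum>e\<in>Basis. (v k \<bullet> e) *\<^sub>R e)" by (simp add: euclidean_representation)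
      also have "\<dots> = (\<Sum>e\<in>Basis. (v k \<bullet> e) *\<^sub>R ?F e)"
        by (simp add: linear_sum[OF F] linear_cmul[OF F] del: fun_upd_apply)
      also have "\<dots> = 0"
      proof (rule sum.neutral, rule ballI)
        fix e :: 'e assume "e \<in> Basis"
        with v have "\<forall>i. k \<le> i \<and> i < l \<longrightarrow> (v(k := e)) i \<in> Basis" by auto
        with Suc have "?F e = 0" by (simp del: fun_upd_apply)
        then show "(v k \<bullet> e) *\<^sub>R ?F e = 0" by simp
      qed
      finally show "alternation l \<beta> v = 0" by simp
    qed
  qed
  from this[of l] show ?thesis by auto
qed

definition reeb_vector ::
    "nat \<Rightarrow> ('e \<Rightarrow> real) \<Rightarrow> ('e \<Rightarrow> 'e \<Rightarrow> real) \<Rightarrow> (nat \<Rightarrow> 'e) \<Rightarrow> 'e::euclidean_space" where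
  "reeb_vector n \<eta> \<omega> b = (\<Sum>k<2 * n + 1.
     (reeb_coeff n \<omega> b k / alternation (2 * n + 1) (lead_pair_product n \<eta> \<omega>) b) *\<^sub>R b k)"

text \<open>If the denominator is not zero, \<open>\<alpha> = \<eta>\<close> gives the value 1; the choice \<open>\<alpha> = \<omega>(b\<^sub>j, \<sqdot>)\<close> gives 0 by
  \<open>alternation_lead_contracted\<close>.\<close>

lemma linear_reeb_vector:
  assumes "linear \<alpha>"
  shows "\<alpha> (reeb_vector n \<eta> \<omega> b) = alternation (2 * n + 1) (lead_pair_product n \<alpha> \<omega>) b
    / alternation (2 * n + 1) (lead_pair_product n \<eta> \<omega>) b"
  unfolding reeb_vector_def sum_reeb_coeff[symmetric]
  by (simp add: linear_sum[OF assms] linear_cmul[OF assms] sum_divide_distrib mult.commute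
      del: sum.lessThan_Suc)

text \<open>Replacing \<open>b\<^sub>k\<close> by \<open>u\<close> multiplies the value of \<open>\<eta> \<and> \<omega>\<^sup>n\<close> on the basis by the \<open>k\<close>-th coordinate of
  \<open>u\<close>. But the new value is zero if both \<open>\<eta>\<close> and \<open>\<omega>\<close> annihilate \<open>u\<close>.\<close>

lemma common_kernel_trivial:
  fixes b :: "nat \<Rightarrow> 'e::euclidean_space"
  assumes \<eta>: "linear \<eta>" and \<omega>: "bilinear \<omega>" and anti: "\<And>x y. \<omega> x y = - \<omega> y x"
    and b: "bij_betw b {..<2 * n + 1} Basis"
    and nz: "alternation (2 * n + 1) (lead_pair_product n \<eta> \<omega>) b \<noteq> 0"
    and u: "\<eta> u = 0" "\<And>x. \<omega> u x = 0"
  shows "u = 0"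
proof (rule euclidean_eqI)
  fix e :: 'e assume "e \<in> Basis"
  with b obtain k where k: "k < 2 * n + 1" "e = b k"
    unfolding bij_betw_def by (metis imageE lessThan_iff)
  let ?F = "\<lambda>x. alternation (2 * n + 1) (lead_pair_product n \<eta> \<omega>) (b(k := x))"
  have F: "linear ?F"
    by (rule linear_alternation[OF linear_lead_pair_product[OF \<eta> \<omega>] k(1)])
  have "?F u = ?F (\<Sum>e\<in>Basis. (u \<bullet> e) *\<^sub>R e)" by (simp add: euclidean_representation)
  also have "\<dots> = (\<Sum>e\<in>Basis. (u \<bullet> e) * ?F e)"
    by (simp only: linear_sum[OF F] linear_cmul[OF F] real_scaleR_def)
  also have "\<dots> = (\<Sum>j<2 * n + 1. (u \<bullet> b j) * ?F (b j))"
    by (rule sum.reindex_bij_betw[OF b, symmetric])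
  also have "\<dots> = (\<Sum>j<2 * n + 1. if j = k then (u \<bullet> e) * ?F e else 0)"
  proof (rule sum.cong[OF refl])
    fix j assume "j \<in> {..<2 * n + 1}"
    then have "?F (b j) = 0" if "j \<noteq> k"
      using alternation_repeated[of j "2 * n + 1" k "b(k := b j)"] that k by simp
    then show "(u \<bullet> b j) * ?F (b j) = (if j = k then (u \<bullet> e) * ?F e else 0)"
      using k(2) by auto
  qed
  also have "\<dots> = (u \<bullet> e) * ?F e" using k(1) by simp
  also have "?F e = alternation (2 * n + 1) (lead_pair_product n \<eta> \<omega>) b" by (simp add: k(2))
  finally have "?F u = (u \<bullet> e) * alternation (2 * n + 1) (lead_pair_product n \<eta> \<omega>) b" .
  moreover have "lead_pair_product n \<eta> \<omega> w = 0" if w: "w j = u" and j: "j < 2 * n + 1" for w j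
  proof (cases j)
    case 0
    then show ?thesis using w u by (simp add: lead_pair_product_def)
  next
    case (Suc i)
    \<comment> \<open>the factor that contains \<open>u\<close>, as its first or its second argument\<close>
    have "\<omega> (w (Suc (2 * (i div 2)))) (w (Suc (2 * (i div 2) + 1))) = 0"
    proof (cases "even i")
      case True
      then show ?thesis using w u Suc by simp
    next
      case False
      then have "2 * (i div 2) + 1 = i" by simp
      then show ?thesis using w u(2) Suc anti[of _ u] by simp
    qed
    moreover have "i div 2 < n" using Suc j by auto
    ultimately have "pair_product n \<omega> (\<lambda>i. w (Suc i)) = 0"
      unfolding pair_product_def by (intro prod_zero bexI[of _ "i div 2"]) auto
    then show ?thesis by (simp add: lead_pair_product_def)
  qed
  note vanish = this
  have "?F u = 0"
    unfolding alternation_def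
  proof (rule sum.neutral, rule ballI)
    fix \<sigma> assume "\<sigma> \<in> {\<sigma>. \<sigma> permutes {..<2 * n + 1}}"
    then have \<sigma>: "\<sigma> permutes {..<2 * n + 1}" by simp
    have "inv \<sigma> k < 2 * n + 1"
      using permutes_in_image[OF permutes_inv[OF \<sigma>], of k] k by auto
    then have "lead_pair_product n \<eta> \<omega> (\<lambda>i. (b(k := u)) (\<sigma> i)) = 0"
      by (rule vanish[rotated]) (use permutes_inverses[OF \<sigma>] in auto)
    then show "of_int (sign \<sigma>) * lead_pair_product n \<eta> \<omega> (\<lambda>i. (b(k := u)) (\<sigma> i)) = 0" by simp
  qed
  ultimately show "u \<bullet> e = 0 \<bullet> e" using nz by simp
qed

lemma reeb_vector:
  fixes b :: "nat \<Rightarrow> 'e::euclidean_space"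
  assumes \<eta>: "linear \<eta>" and \<omega>: "bilinear \<omega>" and anti: "\<And>x y. \<omega> x y = - \<omega> y x"
    and b: "bij_betw b {..<2 * n + 1} Basis"
    and nz: "alternation (2 * n + 1) (lead_pair_product n \<eta> \<omega>) b \<noteq> 0"
  shows "\<eta> (reeb_vector n \<eta> \<omega> b) = 1"
    and "\<omega> (reeb_vector n \<eta> \<omega> b) x = 0"
    and "(\<And>x. \<omega> u x = 0) \<Longrightarrow> u = \<eta> u *\<^sub>R reeb_vector n \<eta> \<omega> b"
proof -
  let ?\<xi> = "reeb_vector n \<eta> \<omega> b"
  have lin: "linear (\<omega> y)" "linear (\<lambda>y. \<omega> y z)" for y z using \<omega> by (auto simp: bilinear_def)
  show one: "\<eta> ?\<xi> = 1" using nz by (simp add: linear_reeb_vector[OF \<eta>])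
  have ker: "\<omega> ?\<xi> x = 0" for x
  proof -
    have "\<omega> ?\<xi> e = 0" if "e \<in> Basis" for e
    proof -
      from b that obtain j where j: "j < 2 * n + 1" "e = b j"
        unfolding bij_betw_def by (metis imageE lessThan_iff)
      show ?thesis
        by (subst anti) (simp add: linear_reeb_vector[OF lin(1)] j(2)
            alternation_lead_contracted[of \<omega>, OF anti j(1), simplified])
    qed
    then have "\<omega> ?\<xi> (\<Sum>e\<in>Basis. (x \<bullet> e) *\<^sub>R e) = 0"
      by (simp add: linear_sum[OF lin(1)] linear_cmul[OF lin(1)])
    then show ?thesis by (simp add: euclidean_representation)
  qed
  show "\<omega> ?\<xi> x = 0" by (rule ker)
  show "u = \<eta> u *\<^sub>R ?\<xi>" if u: "\<And>x. \<omega> u x = 0"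
  proof -
    have "u - \<eta> u *\<^sub>R ?\<xi> = 0"
      by (rule common_kernel_trivial[OF \<eta> \<omega> anti b nz])
        (simp_all add: linear_diff[OF \<eta>] linear_cmul[OF \<eta>] one
          linear_diff[OF lin(2)] linear_cmul[OF lin(2)] ker u)
    then show ?thesis by simp
  qed
qed

text \<open>Induction on the dimension: \<open>V\<close> is the direct sum of a plane spanned by \<open>u\<close>, \<open>w\<close> with
  \<open>\<omega>(u, w) = 1\<close> and its \<open>\<omega>\<close>-orthogonal complement \<open>V'\<close>, on which \<open>\<omega>\<close> is again nondegenerate. The
  value of \<open>\<omega>\<^sup>m\<^sup>+\<^sup>1\<close> on \<open>u\<close>, \<open>w\<close> and vectors of \<open>V'\<close> is a positive multiple of that of \<open>\<omega>\<^sup>m\<close> on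
  the latter, because \<open>\<omega>(u, \<sqdot>)\<close> sees only \<open>w\<close>.\<close>

lemma nondegenerate_pair_product:
  fixes V :: "'e::euclidean_space set"
  assumes \<omega>: "bilinear \<omega>" and anti: "\<And>x y. \<omega> x y = - \<omega> y x"
    and V: "subspace V"
    and nondeg: "\<And>u. u \<in> V \<Longrightarrow> (\<And>x. x \<in> V \<Longrightarrow> \<omega> u x = 0) \<Longrightarrow> u = 0"
  shows "\<exists>m v. dim V = 2 * m \<and> range v \<subseteq> V \<and> alternation (2 * m) (pair_product m \<omega>) v \<noteq> 0"
  using V nondeg
proof (induction "dim V" arbitrary: V rule: less_induct)
  case less
  have lin: "linear (\<omega> y)" "linear (\<lambda>y. \<omega> y z)" for y z using \<omega> by (auto simp: bilinear_def)
  note \<omega>_simps = linear_add[OF lin(1)] linear_diff[OF lin(1)] linear_cmul[OF lin(1)] linear_0[OF lin(1)]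
    linear_add[OF lin(2)] linear_diff[OF lin(2)] linear_cmul[OF lin(2)] linear_0[OF lin(2)]
  have self: "\<omega> x x = 0" for x using anti[of x x] by simp
  show ?case
  proof (cases "V \<subseteq> {0}")
    case True
    then have "V = {0}" using subspace_0[OF less.prems(1)] by auto
    moreover have "{\<sigma> :: nat \<Rightarrow> nat. \<sigma> permutes {..<0}} = {id}" by auto
    ultimately show ?thesis
      by (intro exI[of _ 0] exI[of _ "\<lambda>_. 0"]) (simp add: alternation_def pair_product_def)
  next
    case False
    then obtain u where u: "u \<in> V" "u \<noteq> 0" by auto
    with less.prems(2) obtain w0 where w0: "w0 \<in> V" "\<omega> u w0 \<noteq> 0" by blast
    define w where "w = (1 / \<omega> u w0) *\<^sub>R w0"
    have w: "w \<in> V" "\<omega> u w = 1" "\<omega> w u = -1"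
      using w0 subspace_scale[OF less.prems(1)] anti[of w u] by (auto simp: w_def \<omega>_simps)
    define V' where "V' = {x \<in> V. \<omega> u x = 0 \<and> \<omega> w x = 0}"
    have V': "subspace V'"
      using less.prems(1) by (auto simp: V'_def subspace_def \<omega>_simps)
    \<comment> \<open>the projection to \<open>V'\<close> along the plane\<close>
    have split: "x - (\<omega> u x *\<^sub>R w - \<omega> w x *\<^sub>R u) \<in> V'" if "x \<in> V" for x
      using that u w less.prems(1) unfolding V'_def
      by (auto simp: \<omega>_simps self intro!: subspace_diff subspace_scale)
    have "dim V = dim V' + dim (span {u, w})"
    proof -
      have "{x + y |x y. x \<in> V' \<and> y \<in> span {u, w}} = V"
      proof (intro equalityI subsetI)
        fix z assume "z \<in> {x + y |x y. x \<in> V' \<and> y \<in> span {u, w}}"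
        moreover have "span {u, w} \<subseteq> V" using u w less.prems(1) by (intro span_minimal) auto
        ultimately show "z \<in> V" using less.prems(1) by (auto simp: V'_def intro!: subspace_add)
      next
        fix z assume z: "z \<in> V"
        have "\<omega> u z *\<^sub>R w - \<omega> w z *\<^sub>R u \<in> span {u, w}"
          by (intro span_diff span_scale span_base) auto
        with split[OF z] show "z \<in> {x + y |x y. x \<in> V' \<and> y \<in> span {u, w}}"
          by (intro CollectI exI conjI) auto
      qed
      moreover have "V' \<inter> span {u, w} = {0}"
      proof -
        have "x = 0" if "x \<in> V'" "x \<in> span {u, w}" for x
        proof -
          from that(2) obtain a c where x: "x = a *\<^sub>R u + c *\<^sub>R w"
            by (auto simp: span_insert span_singleton) (metis add.commute diff_add_cancel)
          with that(1) w have "c = 0" "a = 0" by (auto simp: V'_def \<omega>_simps self)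
          with x show ?thesis by simp
        qed
        then show ?thesis using subspace_0[OF V'] span_zero by auto
      qed
      ultimately show ?thesis
        using dim_sums_Int[OF V' subspace_span[of "{u, w}"]] by simp
    qed
    moreover have "dim {u, w} = 2"
    proof -
      have "u \<notin> span {w}"
        using w by (auto simp: span_singleton \<omega>_simps self)
      moreover have "w \<noteq> 0" using w by (auto simp: \<omega>_simps)
      ultimately show ?thesis by (simp add: dim_insert)
    qed
    ultimately have dim: "dim V = dim V' + 2" by simp
    have "\<exists>m v. dim V' = 2 * m \<and> range v \<subseteq> V' \<and> alternation (2 * m) (pair_product m \<omega>) v \<noteq> 0"
    proof (rule less.hyps[OF _ V'])
      show "dim V' < dim V" using dim by simp
    next
      fix z assume z: "z \<in> V'" "\<And>x. x \<in> V' \<Longrightarrow> \<omega> z x = 0"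
      have zuw: "\<omega> z u = 0" "\<omega> z w = 0"
        using z(1) anti[of z u] anti[of z w] by (auto simp: V'_def)
      show "z = 0"
      proof (rule less.prems(2))
        show "z \<in> V" using z by (auto simp: V'_def)
        fix x assume "x \<in> V"
        from z(2)[OF split[OF this]] zuw show "\<omega> z x = 0" by (simp add: \<omega>_simps)
      qed
    qed
    then obtain m v where mv: "dim V' = 2 * m" "range v \<subseteq> V'"
      "alternation (2 * m) (pair_product m \<omega>) v \<noteq> 0" by blast
    define v' where "v' = case_nat u (case_nat w v)"
    have "alternation (2 * Suc m) (pair_product (Suc m) \<omega>) v' =
      2 * real (Suc m) * alternation (2 * m + 1) (lead_pair_product m (\<omega> u) \<omega>) (case_nat w v)"
      by (subst alternation_pair_product_expand[of \<omega>, OF anti]) (simp add: v'_def)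
    also have "alternation (2 * m + 1) (lead_pair_product m (\<omega> u) \<omega>) (case_nat w v)
        = alternation (2 * m) (pair_product m \<omega>) v"
      by (subst alternation_lead_pair_product_fixed) (use mv(2) w in \<open>auto simp: V'_def\<close>)
    finally have "alternation (2 * Suc m) (pair_product (Suc m) \<omega>) v' \<noteq> 0"
      using mv(3) by simp
    moreover have "v' i \<in> V" for i
      using mv(2) u w unfolding v'_def V'_def by (auto split: nat.split simp: image_subset_iff)
    ultimately show ?thesis using dim mv(1) by (intro exI[of _ "Suc m"] exI[of _ v']) auto
  qed
qed

text \<open>The Reeb vector \<open>\<xi>\<close> spans a complement of the kernel of \<open>\<eta>\<close> that is \<open>\<omega>\<close>-orthogonal to everything.
  So \<open>\<omega>\<close> is nondegenerate on the kernel of \<open>\<eta>\<close>, and there \<open>\<omega>\<^sup>n\<close> is nonzero on some vectors; \<open>\<xi>\<close> is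
  put in front of them.\<close>

lemma lead_pair_product_nonzero:
  fixes \<xi> :: "'e::euclidean_space"
  assumes \<eta>: "linear \<eta>" and \<omega>: "bilinear \<omega>" and anti: "\<And>x y. \<omega> x y = - \<omega> y x"
    and dim: "DIM('e) = 2 * n + 1"
    and \<xi>: "\<eta> \<xi> = 1" "\<And>x. \<omega> \<xi> x = 0"
    and ker: "\<And>u. (\<And>x. \<omega> u x = 0) \<Longrightarrow> \<exists>r. u = r *\<^sub>R \<xi>"
  shows "\<exists>v. alternation (2 * n + 1) (lead_pair_product n \<eta> \<omega>) v \<noteq> 0"
proof -
  let ?V = "{x. \<eta> x = 0}"
  have lin: "linear (\<omega> y)" for y using \<omega> by (auto simp: bilinear_def)
  have V: "subspace ?V" by (simp add: subspace_def linear_add[OF \<eta>] linear_cmul[OF \<eta>] linear_0[OF \<eta>])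
  obtain a where a: "\<eta> x = a \<bullet> x" for x
    using adjoint_works[OF \<eta>, of _ 1] by (metis inner_commute inner_real_def mult.right_neutral)
  have "a \<noteq> 0" using \<xi>(1) a by auto
  then have "dim ?V = 2 * n"
    using dim_hyperplane[of a] dim by (simp add: a)
  moreover obtain m v where mv: "dim ?V = 2 * m" "range v \<subseteq> ?V"
      "alternation (2 * m) (pair_product m \<omega>) v \<noteq> 0"
  proof -
    have "u = 0" if u: "u \<in> ?V" "\<And>x. x \<in> ?V \<Longrightarrow> \<omega> u x = 0" for u
    proof -
      have "\<omega> u x = 0" for x
      proof -
        have "\<omega> u (x - \<eta> x *\<^sub>R \<xi>) = 0"
          by (rule u(2)) (simp add: linear_diff[OF \<eta>] linear_cmul[OF \<eta>] \<xi>)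
        moreover have "\<omega> u \<xi> = 0" using \<xi>(2)[of u] anti[of u \<xi>] by simp
        ultimately show ?thesis by (simp add: linear_diff[OF lin] linear_cmul[OF lin])
      qed
      from ker[OF this] obtain r where "u = r *\<^sub>R \<xi>" by blast
      with u(1) \<xi>(1) show ?thesis by (simp add: linear_cmul[OF \<eta>])
    qed
    then show ?thesis
      using nondegenerate_pair_product[of \<omega>, OF \<omega> anti V] that by blast
  qed
  ultimately have "m = n" by simp
  have "alternation (2 * n + 1) (lead_pair_product n \<eta> \<omega>) (case_nat \<xi> v)
      = alternation (2 * n) (pair_product n \<omega>) v"
    by (subst alternation_lead_pair_product_fixed) (use mv(2) \<xi> in auto)
  with mv(3) \<open>m = n\<close> show ?thesis by metis
qed

section \<open>Calculus of smooth maps\<close>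

lemma Ck_on_cong:
  assumes "open S" "\<And>x. x \<in> S \<Longrightarrow> f x = g x" "Ck_on k S f"
  shows "Ck_on k S g"
  using assms(2,3)
proof (induction k arbitrary: f g)
  case 0
  then show ?case by (simp cong: continuous_on_cong)
next
  case (Suc k)
  have diff: "g differentiable (at x)" "frechet_derivative g (at x) = frechet_derivative f (at x)"
    if "x \<in> S" for x
  proof -
    have "(f has_derivative frechet_derivative f (at x)) (at x)"
      using Suc.prems(2) that by (simp add: frechet_derivative_works)
    then have "(g has_derivative frechet_derivative f (at x)) (at x)"
      by (rule has_derivative_transform_within_open[OF _ assms(1) that]) (rule Suc.prems(1))
    then show "g differentiable (at x)" "frechet_derivative g (at x) = frechet_derivative f (at x)"
      by (auto simp: differentiable_def dest: frechet_derivative_at)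
  qed
  have "Ck_on k S (\<lambda>x. frechet_derivative g (at x) v)" for v
    by (rule Suc.IH[of "\<lambda>x. frechet_derivative f (at x) v"]) (use Suc.prems(2) diff in auto)
  then show ?case using diff by simp
qed

text \<open>On an open set a derivative found by the usual rules determines \<open>frechet_derivative\<close> at all nearby
  points, so that smoothness can be checked on the former.\<close>

lemma Ck_on_SucI:
  assumes "open S" "\<And>x. x \<in> S \<Longrightarrow> (f has_derivative f' x) (at x)"
    and "\<And>v. Ck_on k S (\<lambda>x. f' x v)"
  shows "Ck_on (Suc k) S f"
proof -
  have "frechet_derivative f (at x) = f' x" if "x \<in> S" for x
    using frechet_derivative_at[OF assms(2)[OF that]] by simp
  then have "Ck_on k S (\<lambda>x. frechet_derivative f (at x) v)" for v
    by (intro Ck_on_cong[OF assms(1) _ assms(3)]) simp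
  then show ?thesis using assms(2) by (auto simp: differentiable_def)
qed

lemma Ck_on_Suc_derivative:
  "Ck_on (Suc k) S f \<Longrightarrow> x \<in> S \<Longrightarrow> (f has_derivative frechet_derivative f (at x)) (at x)"
  by (simp add: frechet_derivative_works)

lemma Ck_on_Suc_imp:
  "Ck_on (Suc k) S f \<Longrightarrow> Ck_on k S f"
proof (induction k arbitrary: f)
  case 0
  then show ?case
    by (auto intro!: continuous_at_imp_continuous_on differentiable_imp_continuous_within)
next
  case (Suc k)
  then show ?case by (metis Ck_on.simps(2))
qed

lemma Ck_on_Un: "open S \<Longrightarrow> open T \<Longrightarrow> Ck_on k S f \<Longrightarrow> Ck_on k T f \<Longrightarrow> Ck_on k (S \<union> T) f"
proof (induction k arbitrary: f)
  case 0
  then show ?case by (auto intro: continuous_on_open_Un)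
next
  case (Suc k)
  then show ?case by auto
qed

lemma Ck_on_const: "open S \<Longrightarrow> Ck_on k S (\<lambda>x. c)"
proof (induction k arbitrary: c)
  case (Suc k)
  then show ?case by (intro Ck_on_SucI[where f' = "\<lambda>x v. 0"]) auto
qed simp

lemma Ck_on_bounded_linear:
  assumes "bounded_linear L" "open S"
  shows "Ck_on k S f \<Longrightarrow> Ck_on k S (\<lambda>x. L (f x))"
proof (induction k arbitrary: f)
  case 0
  then show ?case by (simp add: bounded_linear.continuous_on[OF assms(1)])
next
  case (Suc k)
  show ?case
    by (rule Ck_on_SucI[OF assms(2) bounded_linear.has_derivative[OF assms(1)
          Ck_on_Suc_derivative[OF Suc.prems]]]) (use Suc in auto)
qed

lemma Ck_on_ident: "open S \<Longrightarrow> Ck_on k S (\<lambda>x. x)"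
  by (cases k) (auto intro!: Ck_on_SucI[where f' = "\<lambda>x v. v"] Ck_on_const)

lemma Ck_on_add:
  assumes "open S"
  shows "Ck_on k S f \<Longrightarrow> Ck_on k S g \<Longrightarrow> Ck_on k S (\<lambda>x. f x + g x)"
proof (induction k arbitrary: f g)
  case 0
  then show ?case by (auto intro: continuous_on_add)
next
  case (Suc k)
  show ?case
    by (rule Ck_on_SucI[OF assms has_derivative_add[OF Ck_on_Suc_derivative[OF Suc.prems(1)]
          Ck_on_Suc_derivative[OF Suc.prems(2)]]]) (use Suc in auto)
qed

lemma Ck_on_sum:
  assumes "open S"
  shows "(\<And>i. i \<in> I \<Longrightarrow> Ck_on k S (f i)) \<Longrightarrow> Ck_on k S (\<lambda>x. \<Sum>i\<in>I. f i x)"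
  by (induction I rule: infinite_finite_induct) (auto intro: Ck_on_const Ck_on_add assms)

lemma Ck_on_bounded_bilinear:
  assumes P: "bounded_bilinear P" and S: "open S"
  shows "Ck_on k S f \<Longrightarrow> Ck_on k S g \<Longrightarrow> Ck_on k S (\<lambda>x. P (f x) (g x))"
proof (induction k arbitrary: f g)
  case 0
  then show ?case by (auto intro: bounded_bilinear.continuous_on[OF P])
next
  case (Suc k)
  show ?case
  proof (rule Ck_on_SucI[OF S bounded_bilinear.FDERIV[OF P Ck_on_Suc_derivative[OF Suc.prems(1)]
          Ck_on_Suc_derivative[OF Suc.prems(2)]]])
    show "Ck_on k S (\<lambda>x. P (f x) (frechet_derivative g (at x) v) + P (frechet_derivative f (at x) v) (g x))" for v
      using Suc.prems by (intro Ck_on_add[OF S] Suc.IH) (auto intro: Ck_on_Suc_imp simp del: Ck_on.simps, auto)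
  qed
qed

text \<open>Only directional derivatives in fixed directions are known to be smooth, so the derivative of the
  outer function in the moving direction \<open>g' v\<close> is expanded in a basis.\<close>

lemma Ck_on_compose:
  fixes f :: "'e::euclidean_space \<Rightarrow> 'b::real_normed_vector"
  assumes S: "open S" and T: "open T"
  shows "Ck_on k S g \<Longrightarrow> Ck_on k T f \<Longrightarrow> g ` S \<subseteq> T \<Longrightarrow> Ck_on k S (\<lambda>x. f (g x))"
proof (induction k arbitrary: f g)
  case 0
  then show ?case by (auto intro: continuous_on_compose2)
next
  case (Suc k)
  let ?g' = "\<lambda>x. frechet_derivative g (at x)" and ?f' = "\<lambda>x. frechet_derivative f (at x)"
  have g: "(g has_derivative ?g' x) (at x)" and f: "(f has_derivative ?f' (g x)) (at (g x))"
    if "x \<in> S" for x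
    using Ck_on_Suc_derivative[OF Suc.prems(1) that] Ck_on_Suc_derivative[OF Suc.prems(2), of "g x"] that
      Suc.prems(3) by auto
  show ?case
  proof (rule Ck_on_SucI[OF S])
    fix x assume x: "x \<in> S"
    show "((\<lambda>x. f (g x)) has_derivative (\<lambda>v. \<Sum>b\<in>Basis. (?g' x v \<bullet> b) *\<^sub>R ?f' (g x) b)) (at x)"
    proof -
      have lin: "linear (?f' (g x))" using f[OF x] by (rule has_derivative_linear)
      have "?f' (g x) (?g' x v) = (\<Sum>b\<in>Basis. (?g' x v \<bullet> b) *\<^sub>R ?f' (g x) b)" for v
        by (subst euclidean_representation[of "?g' x v", symmetric])
          (simp only: linear_sum[OF lin] linear_cmul[OF lin])
      then show ?thesis
        using diff_chain_at[OF g[OF x] f[OF x]] by (simp add: o_def)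
    qed
  next
    fix v
    have gS: "Ck_on k S g" using Suc.prems(1) by (rule Ck_on_Suc_imp)
    have "Ck_on k S (\<lambda>x. ?g' x v \<bullet> b)" for b
      using Suc.prems(1) by (intro Ck_on_bounded_linear[OF bounded_linear_inner_left S]) auto
    moreover have "Ck_on k S (\<lambda>x. ?f' (g x) b)" for b
      using Suc.prems by (intro Suc.IH[OF gS, of "\<lambda>y. ?f' y b"]) auto
    ultimately show "Ck_on k S (\<lambda>x. \<Sum>b\<in>Basis. (?g' x v \<bullet> b) *\<^sub>R ?f' (g x) b)"
      by (intro Ck_on_sum[OF S] Ck_on_bounded_bilinear[OF bounded_bilinear_scaleR S])
  qed
qed

lemma Ck_on_inverse:
  fixes f :: "'a::real_normed_vector \<Rightarrow> real"
  assumes S: "open S" and nz: "\<And>x. x \<in> S \<Longrightarrow> f x \<noteq> 0"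
  shows "Ck_on k S f \<Longrightarrow> Ck_on k S (\<lambda>x. inverse (f x))"
proof (induction k)
  case 0
  then show ?case using nz by (auto intro: continuous_on_inverse)
next
  case (Suc k)
  have inv: "Ck_on k S (\<lambda>x. inverse (f x))"
    by (rule Suc.IH[OF Ck_on_Suc_imp[OF Suc.prems]])
  show ?case
  proof (rule Ck_on_SucI[OF S])
    show "((\<lambda>x. inverse (f x)) has_derivative
        (\<lambda>v. - (inverse (f x) * frechet_derivative f (at x) v * inverse (f x)))) (at x)" if "x \<in> S" for x
      by (rule Deriv.has_derivative_inverse[OF nz[OF that] Ck_on_Suc_derivative[OF Suc.prems that]])
    show "Ck_on k S (\<lambda>x. - (inverse (f x) * frechet_derivative f (at x) v * inverse (f x)))" for v
      using Suc.prems
      by (intro Ck_on_bounded_linear[OF bounded_linear_minus[OF bounded_linear_ident] S]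
          Ck_on_bounded_bilinear[OF bounded_bilinear_mult S] inv) auto
  qed
qed

lemma smooth_on_cong:
  "open S \<Longrightarrow> (\<And>x. x \<in> S \<Longrightarrow> f x = g x) \<Longrightarrow> smooth_on S f \<Longrightarrow> smooth_on S g"
  by (auto simp: smooth_on_def intro: Ck_on_cong)

lemma smooth_on_Un: "open S \<Longrightarrow> open T \<Longrightarrow> smooth_on S f \<Longrightarrow> smooth_on T f \<Longrightarrow> smooth_on (S \<union> T) f"
  by (auto simp: smooth_on_def intro: Ck_on_Un)

lemma smooth_on_const: "open S \<Longrightarrow> smooth_on S (\<lambda>x. c)"
  by (auto simp: smooth_on_def intro: Ck_on_const)

lemma smooth_on_ident: "open S \<Longrightarrow> smooth_on S (\<lambda>x. x)"
  by (auto simp: smooth_on_def intro: Ck_on_ident)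

lemma smooth_on_bounded_linear:
  "bounded_linear L \<Longrightarrow> open S \<Longrightarrow> smooth_on S f \<Longrightarrow> smooth_on S (\<lambda>x. L (f x))"
  by (auto simp: smooth_on_def intro: Ck_on_bounded_linear)

lemma smooth_on_bounded_bilinear:
  "bounded_bilinear P \<Longrightarrow> open S \<Longrightarrow> smooth_on S f \<Longrightarrow> smooth_on S g \<Longrightarrow> smooth_on S (\<lambda>x. P (f x) (g x))"
  by (auto simp: smooth_on_def intro: Ck_on_bounded_bilinear)

lemmas smooth_on_mult = smooth_on_bounded_bilinear[OF bounded_bilinear_mult]
lemmas smooth_on_scaleR = smooth_on_bounded_bilinear[OF bounded_bilinear_scaleR]

lemma smooth_on_add:
  "open S \<Longrightarrow> smooth_on S f \<Longrightarrow> smooth_on S g \<Longrightarrow> smooth_on S (\<lambda>x. f x + g x)"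
  by (auto simp: smooth_on_def intro: Ck_on_add)

lemma smooth_on_diff:
  assumes "open S" "smooth_on S f" "smooth_on S g"
  shows "smooth_on S (\<lambda>x. f x - g x)"
  using smooth_on_add[OF assms(1,2)
      smooth_on_bounded_linear[OF bounded_linear_minus[OF bounded_linear_ident] assms(1,3)]]
  by simp

lemma smooth_on_sum:
  "open S \<Longrightarrow> (\<And>i. i \<in> I \<Longrightarrow> smooth_on S (f i)) \<Longrightarrow> smooth_on S (\<lambda>x. \<Sum>i\<in>I. f i x)"
  by (auto simp: smooth_on_def intro: Ck_on_sum)

lemma smooth_on_prod:
  fixes f :: "'i \<Rightarrow> 'a::real_normed_vector \<Rightarrow> real"
  shows "open S \<Longrightarrow> (\<And>i. i \<in> I \<Longrightarrow> smooth_on S (f i)) \<Longrightarrow> smooth_on S (\<lambda>x. \<Prod>i\<in>I. f i x)"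
  by (induction I rule: infinite_finite_induct) (auto intro: smooth_on_const smooth_on_mult)

lemma smooth_on_divide:
  fixes f g :: "'a::real_normed_vector \<Rightarrow> real"
  assumes "open S" "smooth_on S f" "smooth_on S g" "\<And>x. x \<in> S \<Longrightarrow> g x \<noteq> 0"
  shows "smooth_on S (\<lambda>x. f x / g x)"
  unfolding divide_inverse using assms
  by (intro smooth_on_mult) (auto simp: smooth_on_def intro: Ck_on_inverse)

lemma smooth_on_compose:
  fixes f :: "'e::euclidean_space \<Rightarrow> 'b::real_normed_vector"
  shows "open S \<Longrightarrow> open T \<Longrightarrow> smooth_on S g \<Longrightarrow> smooth_on T f \<Longrightarrow> g ` S \<subseteq> T
    \<Longrightarrow> smooth_on S (\<lambda>x. f (g x))"
  unfolding smooth_on_def using Ck_on_compose by blast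

lemma smooth_on_frechet_derivative:
  "smooth_on S f \<Longrightarrow> smooth_on S (\<lambda>x. frechet_derivative f (at x) v)"
  unfolding smooth_on_def by (metis Ck_on.simps(2))

lemma smooth_on_has_derivative:
  "smooth_on S f \<Longrightarrow> x \<in> S \<Longrightarrow> (f has_derivative frechet_derivative f (at x)) (at x)"
  unfolding smooth_on_def by (metis Ck_on_Suc_derivative)

lemma smooth_on_continuous_on: "smooth_on S f \<Longrightarrow> continuous_on S f"
  unfolding smooth_on_def by (metis Ck_on.simps(1))

text \<open>The derivative of the flat function \<open>exp(- 1 / x)\<close> is not of the same form; with the division by
  \<open>x\<^sup>j\<close>, the family is closed under differentiation up to linear combinations.\<close>

definition flat :: "nat \<Rightarrow> real \<Rightarrow> real" where
  "flat j x = (if x > 0 then exp (- (1 / x)) / x ^ j else 0)"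

lemma flat_has_derivative: "(flat j has_real_derivative flat (j + 2) x - j * flat (j + 1) x) (at x)"
proof -
  consider "x > 0" | "x < 0" | "x = 0" by linarith
  then show ?thesis
  proof cases
    case 1
    have "((\<lambda>x. exp (- (1 / x))) has_real_derivative exp (- (1 / x)) / x\<^sup>2) (at x)"
      using 1 by (auto intro!: derivative_eq_intros simp: power2_eq_square)
    from DERIV_divide[OF this DERIV_pow[of j x UNIV]] 1
    have "((\<lambda>x. exp (- (1 / x)) / x ^ j) has_real_derivative
        (exp (- (1 / x)) / x\<^sup>2 * x ^ j - exp (- (1 / x)) * (j * x ^ (j - Suc 0))) / (x ^ j * x ^ j)) (at x)"
      by simp
    also have "(exp (- (1 / x)) / x\<^sup>2 * x ^ j - exp (- (1 / x)) * (j * x ^ (j - Suc 0))) / (x ^ j * x ^ j)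
        = flat (j + 2) x - j * flat (j + 1) x"
      using 1 by (cases j) (simp_all add: flat_def field_simps power2_eq_square)
    finally have "((\<lambda>x. exp (- (1 / x)) / x ^ j) has_real_derivative flat (j + 2) x - j * flat (j + 1) x) (at x)" .
    moreover have "eventually (\<lambda>x. flat j x = exp (- (1 / x)) / x ^ j) (nhds x)"
      using eventually_nhds_in_open[of "{0<..}" x] 1 by (auto simp: flat_def elim: eventually_mono)
    ultimately show ?thesis by (simp add: DERIV_cong_ev)
  next
    case 2
    have "eventually (\<lambda>x. flat j x = 0) (nhds x)"
      using eventually_nhds_in_open[of "{..<0}" x] 2 by (auto simp: flat_def elim: eventually_mono)
    then have "(flat j has_real_derivative 0) (at x) \<longleftrightarrow> ((\<lambda>x. 0) has_real_derivative 0) (at x)"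
      by (intro DERIV_cong_ev) auto
    then show ?thesis using 2 by (simp add: flat_def)
  next
    case 3
    \<comment> \<open>This is the difference quotient at 0 from the right.\<close>
    have "((\<lambda>x. inverse x ^ Suc j / exp (inverse x)) \<longlongrightarrow> 0) (at_right (0::real))"
      by (rule filterlim_compose[OF tendsto_power_div_exp_0 filterlim_inverse_at_top_right])
    then have "((\<lambda>y. (flat j y - flat j 0) / (y - 0)) \<longlongrightarrow> 0) (at_right 0)"
    proof (rule Lim_transform_eventually)
      show "eventually (\<lambda>x. inverse x ^ Suc j / exp (inverse x) = (flat j x - flat j 0) / (x - 0)) (at_right 0)"
        using eventually_at_right_less
        by eventually_elim (simp add: flat_def exp_minus field_simps)
    qed
    moreover have "((\<lambda>y. (flat j y - flat j 0) / (y - 0)) \<longlongrightarrow> 0) (at_left 0)"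
    proof (rule tendsto_eventually)
      show "eventually (\<lambda>y. (flat j y - flat j 0) / (y - 0) = 0) (at_left 0)"
        by (simp add: eventually_at_filter flat_def)
    qed
    ultimately have "((\<lambda>y. (flat j y - flat j 0) / (y - 0)) \<longlongrightarrow> 0) (at 0)"
      by (simp add: filterlim_split_at)
    then show ?thesis using 3 by (simp add: has_field_derivative_iff flat_def)
  qed
qed

lemma smooth_on_flat: "smooth_on UNIV (flat j)"
proof -
  have "Ck_on k UNIV (flat j)" for k j
  proof (induction k arbitrary: j)
    case 0
    have "isCont (flat j) x" for x
      using flat_has_derivative[of j x] by (rule DERIV_isCont)
    then show ?case by (auto intro: continuous_at_imp_continuous_on)
  next
    case (Suc k)
    show ?case
    proof (rule Ck_on_SucI)
      show "(flat j has_derivative (*) (flat (j + 2) x - j * flat (j + 1) x)) (at x)" for x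
        using flat_has_derivative[of j x] by (simp add: has_field_derivative_def)
      have "Ck_on k UNIV (\<lambda>x. (flat (j + 2) x + (- real j) * flat (j + 1) x) * v)" for v
        by (intro Ck_on_bounded_bilinear[OF bounded_bilinear_mult] Ck_on_add Ck_on_const Suc.IH) auto
      then show "Ck_on k UNIV (\<lambda>x. (flat (j + 2) x - j * flat (j + 1) x) * v)" for v by simp
    qed simp
  qed
  then show ?thesis by (simp add: smooth_on_def)
qed

lemma bump_function_exists:
  fixes a :: "'e::euclidean_space"
  assumes "r > 0"
  obtains \<psi> :: "'e \<Rightarrow> real" where "smooth_on UNIV \<psi>" "\<psi> a = 1" "\<And>y. y \<notin> cball a r \<Longrightarrow> \<psi> y = 0"
proof
  \<comment> \<open>positive exactly in the open ball\<close>
  let ?g = "\<lambda>y. r\<^sup>2 - (y - a) \<bullet> (y - a)"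
  let ?\<psi> = "\<lambda>y. flat 0 (?g y) / flat 0 (r\<^sup>2)"
  have pos: "flat 0 (r\<^sup>2) > 0" using assms by (simp add: flat_def)
  have "smooth_on UNIV ?g"
    by (intro smooth_on_diff smooth_on_const smooth_on_bounded_bilinear[OF bounded_bilinear_inner]
        smooth_on_ident) auto
  then have "smooth_on UNIV (\<lambda>y. flat 0 (?g y))"
    by (intro smooth_on_compose[OF _ _ _ smooth_on_flat]) auto
  then show "smooth_on UNIV ?\<psi>"
    using pos by (intro smooth_on_divide smooth_on_const) auto
  show "?\<psi> a = 1" using pos by simp
  show "?\<psi> y = 0" if "y \<notin> cball a r" for y
  proof -
    have "r < norm (y - a)" using that by (simp add: dist_norm norm_minus_commute)
    then have "r\<^sup>2 < (norm (y - a))\<^sup>2" using assms by (intro power_strict_mono) auto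
    then show ?thesis by (simp add: power2_norm_eq_inner flat_def)
  qed
qed

lemma has_real_derivative_along_line:
  assumes "(g has_derivative g') (at (c + s *\<^sub>R z))"
  shows "((\<lambda>s. g (c + s *\<^sub>R z)) has_real_derivative g' z) (at s)"
proof -
  have "((\<lambda>s. c + s *\<^sub>R z) has_derivative (\<lambda>t. t *\<^sub>R z)) (at s)"
    by (auto intro!: derivative_eq_intros)
  from diff_chain_at[OF this, of g g'] assms
  have "((\<lambda>s. g (c + s *\<^sub>R z)) has_derivative (\<lambda>t. g' (t *\<^sub>R z))) (at s)" by (simp add: o_def)
  moreover have "(\<lambda>t. g' (t *\<^sub>R z)) = (*) (g' z)"
    using linear_cmul[OF has_derivative_linear[OF assms]] by (auto simp: fun_eq_iff)
  ultimately show ?thesis by (simp add: has_field_derivative_def)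
qed

text \<open>The mean value theorem is applied twice: first to the difference of \<open>f\<close> along the two edges of the
  parallelogram that are parallel to \<open>z\<close>, then to \<open>D z\<close> along a line in direction \<open>w\<close>.\<close>

lemma second_difference_mean_value:
  fixes f :: "'e::real_normed_vector \<Rightarrow> real"
  defines "D \<equiv> \<lambda>v x. frechet_derivative f (at x) v"
  assumes f: "smooth_on S f" and h: "h > 0"
    and S: "\<And>s t. 0 \<le> s \<Longrightarrow> s \<le> h \<Longrightarrow> 0 \<le> t \<Longrightarrow> t \<le> h \<Longrightarrow> y + s *\<^sub>R z + t *\<^sub>R w \<in> S"
  obtains s t where "0 < s" "s < h" "0 < t" "t < h"
    "f (y + h *\<^sub>R z + h *\<^sub>R w) - f (y + h *\<^sub>R z) - f (y + h *\<^sub>R w) + f y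
      = h\<^sup>2 * frechet_derivative (D z) (at (y + s *\<^sub>R z + t *\<^sub>R w)) w"
proof -
  let ?\<phi> = "\<lambda>s. f (y + h *\<^sub>R w + s *\<^sub>R z) - f (y + s *\<^sub>R z)"
  have D: "smooth_on S (D z)" unfolding D_def by (rule smooth_on_frechet_derivative[OF f])
  have "\<exists>s>0. s < h \<and> ?\<phi> h - ?\<phi> 0 = (h - 0) * (D z (y + h *\<^sub>R w + s *\<^sub>R z) - D z (y + s *\<^sub>R z))"
  proof (rule MVT2[OF h])
    fix s assume s: "0 \<le> s" "s \<le> h"
    have "y + h *\<^sub>R w + s *\<^sub>R z \<in> S" "y + s *\<^sub>R z \<in> S"
      using S[of s h] S[of s 0] s h by (auto simp: algebra_simps)
    from this[THEN smooth_on_has_derivative[OF f]]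
    show "(?\<phi> has_real_derivative D z (y + h *\<^sub>R w + s *\<^sub>R z) - D z (y + s *\<^sub>R z)) (at s)"
      unfolding D_def by (intro DERIV_diff has_real_derivative_along_line)
  qed
  then obtain s where s: "0 < s" "s < h"
    "?\<phi> h - ?\<phi> 0 = h * (D z (y + h *\<^sub>R w + s *\<^sub>R z) - D z (y + s *\<^sub>R z))" by auto
  let ?\<theta> = "\<lambda>t. D z (y + s *\<^sub>R z + t *\<^sub>R w)"
  have "\<exists>t>0. t < h \<and> ?\<theta> h - ?\<theta> 0
      = (h - 0) * frechet_derivative (D z) (at (y + s *\<^sub>R z + t *\<^sub>R w)) w"
  proof (rule MVT2[OF h])
    fix t assume t: "0 \<le> t" "t \<le> h"
    have "y + s *\<^sub>R z + t *\<^sub>R w \<in> S" using S[of s t] s t by auto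
    from smooth_on_has_derivative[OF D this]
    show "(?\<theta> has_real_derivative frechet_derivative (D z) (at (y + s *\<^sub>R z + t *\<^sub>R w)) w) (at t)"
      by (rule has_real_derivative_along_line)
  qed
  then obtain t where t: "0 < t" "t < h"
    "?\<theta> h - ?\<theta> 0 = h * frechet_derivative (D z) (at (y + s *\<^sub>R z + t *\<^sub>R w)) w" by auto
  show thesis
  proof (rule that[OF s(1,2) t(1,2)])
    have "f (y + h *\<^sub>R z + h *\<^sub>R w) - f (y + h *\<^sub>R z) - f (y + h *\<^sub>R w) + f y = ?\<phi> h - ?\<phi> 0"
      by (simp add: algebra_simps)
    also have "\<dots> = h * (?\<theta> h - ?\<theta> 0)" unfolding s(3) by (simp add: algebra_simps)
    finally show "f (y + h *\<^sub>R z + h *\<^sub>R w) - f (y + h *\<^sub>R z) - f (y + h *\<^sub>R w) + f y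
      = h\<^sup>2 * frechet_derivative (D z) (at (y + s *\<^sub>R z + t *\<^sub>R w)) w"
      unfolding t(3) by (simp add: power2_eq_square)
  qed
qed

text \<open>Schwarz's theorem. The second difference is symmetric in \<open>z\<close> and \<open>w\<close>, and by
  \<open>second_difference_mean_value\<close> both mixed second derivatives are limits of it divided by
  \<open>h\<^sup>2\<close>.\<close>

lemma second_derivative_symmetric:
  fixes f :: "'e::real_normed_vector \<Rightarrow> real"
  assumes S: "open S" and f: "smooth_on S f" and y: "y \<in> S"
  shows "frechet_derivative (\<lambda>x. frechet_derivative f (at x) z) (at y) w
    = frechet_derivative (\<lambda>x. frechet_derivative f (at x) w) (at y) z"
proof (rule ccontr)
  define E where "E u v x = frechet_derivative (\<lambda>x. frechet_derivative f (at x) v) (at x) u" for u v x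
  assume "frechet_derivative (\<lambda>x. frechet_derivative f (at x) z) (at y) w
    \<noteq> frechet_derivative (\<lambda>x. frechet_derivative f (at x) w) (at y) z"
  then have ne: "E w z y \<noteq> E z w y" by (simp add: E_def)
  define \<epsilon> where "\<epsilon> = \<bar>E w z y - E z w y\<bar> / 2"
  have \<epsilon>: "\<epsilon> > 0" using ne by (simp add: \<epsilon>_def)
  have cont: "continuous_on S (\<lambda>x. E u v x)" for u v
    unfolding E_def by (intro smooth_on_continuous_on smooth_on_frechet_derivative f)
  obtain r where r: "r > 0" "ball y r \<subseteq> S"
    using open_contains_ball_eq[OF S] y by auto
  have near_y: "\<exists>d>0. \<forall>x. x \<in> ball y d \<longrightarrow> x \<in> S \<longrightarrow> \<bar>g x - g y\<bar> < \<epsilon>"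
    if "continuous_on S g" for g :: "'e \<Rightarrow> real"
  proof -
    have "\<exists>d>0. \<forall>x\<in>S. dist x y < d \<longrightarrow> dist (g x) (g y) < \<epsilon>"
      using that[unfolded continuous_on_iff] y \<epsilon> by simp
    then obtain d where "d > 0" "\<forall>x\<in>S. dist x y < d \<longrightarrow> dist (g x) (g y) < \<epsilon>" by auto
    then show ?thesis by (intro exI[of _ d]) (auto simp: dist_commute dist_real_def)
  qed
  obtain d1 where d1: "d1 > 0" "\<And>x. x \<in> ball y d1 \<Longrightarrow> x \<in> S \<Longrightarrow> \<bar>E w z x - E w z y\<bar> < \<epsilon>"
    using near_y[OF cont[where u = w and v = z]] that by blast
  obtain d2 where d2: "d2 > 0" "\<And>x. x \<in> ball y d2 \<Longrightarrow> x \<in> S \<Longrightarrow> \<bar>E z w x - E z w y\<bar> < \<epsilon>"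
    using near_y[OF cont[where u = z and v = w]] that by blast
  define d where "d = min r (min d1 d2)"
  have d: "d > 0" using r d1 d2 by (simp add: d_def)
  define N where "N = norm z + norm w + 1"
  have N: "N > 0" unfolding N_def by (intro add_nonneg_pos) auto
  \<comment> \<open>so small that the parallelogram spanned by \<open>h z\<close> and \<open>h w\<close> at \<open>y\<close> lies in the ball of radius \<open>d\<close>\<close>
  define h where "h = d / (2 * N)"
  have h: "h > 0" using d N by (simp add: h_def)
  have near: "y + s *\<^sub>R a + t *\<^sub>R c \<in> ball y d"
    if "0 \<le> s" "s \<le> h" "0 \<le> t" "t \<le> h" "norm a + norm c = norm z + norm w" for s t a c
  proof -
    have "norm (s *\<^sub>R a + t *\<^sub>R c) \<le> s * norm a + t * norm c"
      using norm_triangle_ineq[of "s *\<^sub>R a" "t *\<^sub>R c"] that by simp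
    also have "\<dots> \<le> h * norm a + h * norm c"
      using that by (intro add_mono mult_right_mono) auto
    also have "\<dots> = h * (norm z + norm w)" using that(5) by (metis distrib_left)
    also have "\<dots> < h * N" using h by (simp add: N_def)
    also have "\<dots> = d / 2" using N by (simp add: h_def)
    also have "\<dots> < d" using d by simp
    finally show ?thesis by (simp add: dist_norm norm_minus_commute add.commute add.left_commute)
  qed
  have dS: "ball y d \<subseteq> S" using r by (auto simp: d_def)
  obtain s t where st: "0 < s" "s < h" "0 < t" "t < h"
    "f (y + h *\<^sub>R z + h *\<^sub>R w) - f (y + h *\<^sub>R z) - f (y + h *\<^sub>R w) + f y
      = h\<^sup>2 * E w z (y + s *\<^sub>R z + t *\<^sub>R w)"
    unfolding E_def by (rule second_difference_mean_value[OF f h, of y z w]) (use near dS in auto)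
  obtain s' t' where st': "0 < s'" "s' < h" "0 < t'" "t' < h"
    "f (y + h *\<^sub>R w + h *\<^sub>R z) - f (y + h *\<^sub>R w) - f (y + h *\<^sub>R z) + f y
      = h\<^sup>2 * E z w (y + s' *\<^sub>R w + t' *\<^sub>R z)"
    unfolding E_def by (rule second_difference_mean_value[OF f h, of y w z]) (use near dS in auto)
  have "h\<^sup>2 * E w z (y + s *\<^sub>R z + t *\<^sub>R w) = h\<^sup>2 * E z w (y + s' *\<^sub>R w + t' *\<^sub>R z)"
    using st(5) st'(5) by (simp add: algebra_simps)
  then have eq: "E w z (y + s *\<^sub>R z + t *\<^sub>R w) = E z w (y + s' *\<^sub>R w + t' *\<^sub>R z)"
    using h by simp
  have p: "y + s *\<^sub>R z + t *\<^sub>R w \<in> ball y d" "y + s' *\<^sub>R w + t' *\<^sub>R z \<in> ball y d"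
    using near st st' by auto
  have "\<bar>E w z (y + s *\<^sub>R z + t *\<^sub>R w) - E w z y\<bar> < \<epsilon>"
    by (rule d1(2)) (use p(1) dS in \<open>auto simp: d_def\<close>)
  moreover have "\<bar>E z w (y + s' *\<^sub>R w + t' *\<^sub>R z) - E z w y\<bar> < \<epsilon>"
    by (rule d2(2)) (use p(2) dS in \<open>auto simp: d_def\<close>)
  moreover have "\<bar>a - b\<bar> \<le> \<bar>p - a\<bar> + \<bar>p - b\<bar>" for a b p :: real by linarith
  ultimately show False unfolding eq \<epsilon>_def by (smt (verit) field_sum_of_halves)
qed

lemma second_derivative_symmetric_euclidean:
  fixes f :: "'e::real_normed_vector \<Rightarrow> 'b::euclidean_space"
  assumes S: "open S" and f: "smooth_on S f" and y: "y \<in> S"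
  shows "frechet_derivative (\<lambda>x. frechet_derivative f (at x) z) (at y) w
    = frechet_derivative (\<lambda>x. frechet_derivative f (at x) w) (at y) z"
proof (rule euclidean_eqI)
  fix b :: 'b assume "b \<in> Basis"
  let ?f = "\<lambda>x. f x \<bullet> b"
  have inner: "bounded_linear (\<lambda>x. x \<bullet> b)" by (rule bounded_linear_inner_left)
  have f': "frechet_derivative ?f (at x) v = frechet_derivative f (at x) v \<bullet> b" if "x \<in> S" for x v
    using frechet_derivative_at[OF bounded_linear.has_derivative[OF inner smooth_on_has_derivative[OF f that]]]
    by metis
  have "frechet_derivative (\<lambda>x. frechet_derivative f (at x) v) (at y) u \<bullet> b
      = frechet_derivative (\<lambda>x. frechet_derivative ?f (at x) v) (at y) u" for u v
  proof -
    have "((\<lambda>x. frechet_derivative f (at x) v \<bullet> b) has_derivative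
        (\<lambda>u. frechet_derivative (\<lambda>x. frechet_derivative f (at x) v) (at y) u \<bullet> b)) (at y)"
      by (rule bounded_linear.has_derivative[OF inner
            smooth_on_has_derivative[OF smooth_on_frechet_derivative[OF f] y]])
    then have "((\<lambda>x. frechet_derivative ?f (at x) v) has_derivative
        (\<lambda>u. frechet_derivative (\<lambda>x. frechet_derivative f (at x) v) (at y) u \<bullet> b)) (at y)"
      by (rule has_derivative_transform_within_open[OF _ S y]) (simp add: f')
    from frechet_derivative_at[OF this] show ?thesis by metis
  qed
  then show "frechet_derivative (\<lambda>x. frechet_derivative f (at x) z) (at y) w \<bullet> b
    = frechet_derivative (\<lambda>x. frechet_derivative f (at x) w) (at y) z \<bullet> b"
    using second_derivative_symmetric[OF S smooth_on_bounded_linear[OF inner S f] y] by simp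
qed

lemma smooth_on_alternation_lead_pair_product:
  assumes S: "open S" and \<eta>: "\<And>i. smooth_on S (\<lambda>y. \<eta> y (b i))"
    and \<omega>: "\<And>i j. smooth_on S (\<lambda>y. \<omega> y (b i) (b j))"
  shows "smooth_on S (\<lambda>y. alternation l (lead_pair_product n (\<eta> y) (\<omega> y)) b)"
  unfolding alternation_def lead_pair_product_def pair_product_def
proof (rule smooth_on_sum[OF S])
  fix \<sigma> :: "nat \<Rightarrow> nat"
  show "smooth_on S (\<lambda>y. of_int (sign \<sigma>) *
      (\<eta> y (b (\<sigma> 0)) * (\<Prod>i<n. \<omega> y (b (\<sigma> (Suc (2 * i)))) (b (\<sigma> (Suc (2 * i + 1)))))))"
    by (rule smooth_on_mult[OF S smooth_on_const[OF S] smooth_on_mult[OF S \<eta> smooth_on_prod[OF S \<omega>]]])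
qed

lemma smooth_on_reeb_coeff:
  assumes S: "open S" and \<omega>: "\<And>i j. smooth_on S (\<lambda>y. \<omega> y (b i) (b j))"
  shows "smooth_on S (\<lambda>y. reeb_coeff n (\<omega> y) b k)"
  unfolding reeb_coeff_def pair_product_def
proof (rule smooth_on_sum[OF S])
  fix \<sigma> :: "nat \<Rightarrow> nat"
  show "smooth_on S (\<lambda>y. of_int (sign \<sigma>) *
      (\<Prod>i<n. \<omega> y (b (\<sigma> (Suc (2 * i)))) (b (\<sigma> (Suc (2 * i + 1))))))"
    by (rule smooth_on_mult[OF S smooth_on_const[OF S] smooth_on_prod[OF S \<omega>]])
qed

text \<open>The Reeb vector is a rational expression in the coefficients of the two forms with respect to a
  constant basis.\<close>

lemma smooth_on_reeb_vector:
  fixes b :: "nat \<Rightarrow> 'e::euclidean_space"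
  assumes S: "open S" and \<eta>: "\<And>i. smooth_on S (\<lambda>y. \<eta> y (b i))"
    and \<omega>: "\<And>i j. smooth_on S (\<lambda>y. \<omega> y (b i) (b j))"
    and nz: "\<And>y. y \<in> S \<Longrightarrow> alternation (2 * n + 1) (lead_pair_product n (\<eta> y) (\<omega> y)) b \<noteq> 0"
  shows "smooth_on S (\<lambda>y. reeb_vector n (\<eta> y) (\<omega> y) b)"
proof -
  let ?F = "\<lambda>y. alternation (2 * n + 1) (lead_pair_product n (\<eta> y) (\<omega> y)) b"
  have "smooth_on S ?F"
    by (rule smooth_on_alternation_lead_pair_product) (fact S \<eta> \<omega>)+
  moreover have "smooth_on S (\<lambda>y. reeb_coeff n (\<omega> y) b k)" for k
    by (rule smooth_on_reeb_coeff) (fact S \<omega>)+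
  ultimately have "smooth_on S (\<lambda>y. reeb_coeff n (\<omega> y) b k / ?F y)" for k
    using nz by (intro smooth_on_divide[OF S]) auto
  then show ?thesis
    unfolding reeb_vector_def
    by (intro smooth_on_sum[OF S] smooth_on_scaleR[OF S _ smooth_on_const[OF S]])
qed

section \<open>Tangent vectors and vector fields\<close>

context
  fixes A :: "('a::{t2_space,second_countable_topology}, 'e::euclidean_space) chart set"
  assumes M: "smooth_manifold A"
begin

lemma charts_at_nonempty: "\<exists>c. c \<in> charts_at A p"
proof -
  have "p \<in> (\<Union>c\<in>A. fst c)" using M by (simp add: smooth_manifold_def)
  then show ?thesis unfolding charts_at_def by blast
qed

lemma is_chart: "c \<in> A \<Longrightarrow> is_chart c"
  using M by (simp add: smooth_manifold_def)

lemma chart_inv_coord [simp]: "c \<in> A \<Longrightarrow> p \<in> fst c \<Longrightarrow> chart_inv c (snd c p) = p"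
  using is_chart[of c] by (simp add: is_chart_def homeomorphism_def)

lemma open_chart_image:
  assumes c: "c \<in> A" and U: "open U"
  shows "open (snd c ` (fst c \<inter> U))"
proof -
  have "snd c ` (fst c \<inter> U) = snd c ` fst c \<inter> chart_inv c -` U"
    using c by auto
  moreover have "open (snd c ` fst c \<inter> chart_inv c -` U)"
    using is_chart[OF c] U
    by (intro continuous_open_preimage) (auto simp: is_chart_def homeomorphism_def)
  ultimately show ?thesis by simp
qed

lemma open_chart_domain: "c \<in> A \<Longrightarrow> open (fst c)"
  using is_chart[of c] by (simp add: is_chart_def)

lemma open_overlap: "c \<in> A \<Longrightarrow> c' \<in> A \<Longrightarrow> open (snd c ` (fst c \<inter> fst c'))"
  by (intro open_chart_image open_chart_domain)

lemma smooth_transition: "c \<in> A \<Longrightarrow> c' \<in> A \<Longrightarrow> smooth_on (snd c ` (fst c \<inter> fst c')) (transition c c')"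
  using M by (simp add: smooth_manifold_def)

lemma transition_coord [simp]: "c \<in> A \<Longrightarrow> p \<in> fst c \<Longrightarrow> transition c c' (snd c p) = snd c' p"
  by (simp add: transition_def)

lemma transition_has_derivative:
  assumes "c \<in> charts_at A p" "c' \<in> charts_at A p"
  shows "(transition c c' has_derivative frechet_derivative (transition c c') (at (snd c p))) (at (snd c p))"
  using assms by (intro smooth_on_has_derivative[OF smooth_transition]) (auto simp: charts_at_def)

lemma linear_transition_derivative:
  "c \<in> charts_at A p \<Longrightarrow> c' \<in> charts_at A p
    \<Longrightarrow> linear (frechet_derivative (transition c c') (at (snd c p)))"
  using transition_has_derivative has_derivative_linear by blast

lemma transition_derivative_chain:
  assumes c: "c \<in> charts_at A p" "c' \<in> charts_at A p" "c'' \<in> charts_at A p"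
  shows "frechet_derivative (transition c' c'') (at (snd c' p))
      (frechet_derivative (transition c c') (at (snd c p)) w)
    = frechet_derivative (transition c c'') (at (snd c p)) w"
proof -
  let ?U = "snd c ` (fst c \<inter> (fst c' \<inter> fst c''))"
  have "(transition c' c'' has_derivative frechet_derivative (transition c' c'') (at (snd c' p)))
      (at (transition c c' (snd c p)))"
    using transition_has_derivative[OF c(2,3)] c by (simp add: charts_at_def)
  from diff_chain_at[OF transition_has_derivative[OF c(1,2)] this]
  have "(transition c c'' has_derivative frechet_derivative (transition c' c'') (at (snd c' p))
      \<circ> frechet_derivative (transition c c') (at (snd c p))) (at (snd c p))"
  proof (rule has_derivative_transform_within_open[of _ _ _ _ ?U])
    show "open ?U" using c by (intro open_chart_image open_Int open_chart_domain) (auto simp: charts_at_def)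
    show "snd c p \<in> ?U" using c by (auto simp: charts_at_def)
    show "(transition c' c'' \<circ> transition c c') x = transition c c'' x" if "x \<in> ?U" for x
      using that c by (auto simp: charts_at_def)
  qed
  from frechet_derivative_at[OF this] show ?thesis by (metis comp_apply)
qed

lemma transition_derivative_self:
  assumes c: "c \<in> charts_at A p"
  shows "frechet_derivative (transition c c) (at (snd c p)) w = w"
proof -
  have "(transition c c has_derivative (\<lambda>w. w)) (at (snd c p))"
  proof (rule has_derivative_transform_within_open[OF has_derivative_ident, of "snd c ` (fst c \<inter> fst c)"])
    show "open (snd c ` (fst c \<inter> fst c))" using c by (intro open_overlap) (auto simp: charts_at_def)
  qed (use c in \<open>auto simp: charts_at_def\<close>)
  from frechet_derivative_at[OF this] show ?thesis by metis
qed

lemma coord_vec_in_tangent_space: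
  "c \<in> charts_at A p \<Longrightarrow> coord_vec A c p w \<in> tangent_space A p"
  by (simp add: tangent_space_def coord_vec_def transition_derivative_chain)

lemma coord_vec_self: "c \<in> charts_at A p \<Longrightarrow> coord_vec A c p w c = w"
  by (simp add: coord_vec_def transition_derivative_self)

lemma coord_vec_of_tangent:
  assumes c: "c \<in> charts_at A p" and v: "v \<in> tangent_space A p"
  shows "coord_vec A c p (v c) = v"
proof
  fix c'
  show "coord_vec A c p (v c) c' = v c'"
  proof (cases "c' \<in> charts_at A p")
    case True
    with c v have "v c' = frechet_derivative (transition c c') (at (snd c p)) (v c)"
      unfolding tangent_space_def by blast
    with True show ?thesis by (simp add: coord_vec_def)
  next
    case False
    with v have "v c' = 0" unfolding tangent_space_def by blast
    with False show ?thesis by (simp add: coord_vec_def)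
  qed
qed

lemma coord_vec_add:
  "c \<in> charts_at A p \<Longrightarrow> coord_vec A c p (u + v) = coord_vec A c p u + coord_vec A c p v"
  by (auto simp: coord_vec_def fun_eq_iff linear_add[OF linear_transition_derivative])

lemma coord_vec_scaleR:
  "c \<in> charts_at A p \<Longrightarrow> coord_vec A c p (r *\<^sub>R u) = r *\<^sub>R coord_vec A c p u"
  by (auto simp: coord_vec_def fun_eq_iff scaleR_fun_def linear_cmul[OF linear_transition_derivative])

lemma coord_vec_change_chart:
  assumes "c \<in> charts_at A p" "c' \<in> charts_at A p"
  shows "coord_vec A c p w
    = coord_vec A c' p (frechet_derivative (transition c c') (at (snd c p)) w)"
  using coord_vec_of_tangent[OF assms(2) coord_vec_in_tangent_space[OF assms(1)], of w] assms(2)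
  by (simp add: coord_vec_def)

lemma tangent_space_scaleR:
  assumes "v \<in> tangent_space A p"
  shows "r *\<^sub>R v \<in> tangent_space A p"
proof -
  obtain c where c: "c \<in> charts_at A p" using charts_at_nonempty by blast
  have "r *\<^sub>R v = coord_vec A c p (r *\<^sub>R v c)"
    by (simp add: coord_vec_scaleR[OF c] coord_vec_of_tangent[OF c assms])
  then show ?thesis using coord_vec_in_tangent_space[OF c] by simp
qed

lemma tangent_space_zero: "0 \<in> tangent_space A p"
proof -
  obtain c where "c \<in> charts_at A p" using charts_at_nonempty by blast
  then show ?thesis using tangent_space_scaleR[OF coord_vec_in_tangent_space, of c p 0 0] by simp
qed

text \<open>In a chart around \<open>p\<close> the constant field is multiplied by a bump function and extended by zero.
  The support is compact, hence closed in the Hausdorff space, so the extension is smooth: every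
  chart image is covered by two open sets, on one of which the field is given by the chart around
  \<open>p\<close> and on the other of which it vanishes.\<close>

lemma tangent_vector_extends:
  assumes v: "v \<in> tangent_space A p"
  obtains X where "vector_field A UNIV X" "X p = v"
proof -
  obtain c where c: "c \<in> charts_at A p" using charts_at_nonempty by blast
  then have cA: "c \<in> A" and pc: "p \<in> fst c" by (auto simp: charts_at_def)
  have "open (snd c ` fst c)" using open_chart_image[OF cA open_UNIV] by simp
  then obtain r where r: "r > 0" "cball (snd c p) r \<subseteq> snd c ` fst c"
    using open_contains_cball_eq pc by blast
  obtain \<psi> :: "'e \<Rightarrow> real" where \<psi>: "smooth_on UNIV \<psi>" "\<psi> (snd c p) = 1"
    "\<And>y. y \<notin> cball (snd c p) r \<Longrightarrow> \<psi> y = 0"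
    using bump_function_exists[OF r(1)] by blast
  define K where "K = chart_inv c ` cball (snd c p) r"
  have "continuous_on (snd c ` fst c) (chart_inv c)"
    using is_chart[OF cA] by (simp add: is_chart_def homeomorphism_def)
  then have "compact K"
    unfolding K_def using r(2) by (intro compact_continuous_image) (auto intro: continuous_on_subset)
  then have K: "open (- K)" by (intro open_Compl compact_imp_closed)
  have Kc: "K \<subseteq> fst c" using r(2) cA unfolding K_def by auto
  define X where "X q = (if q \<in> fst c then \<psi> (snd c q) *\<^sub>R coord_vec A c q (v c) else 0)" for q
  have at: "c \<in> charts_at A q" if "q \<in> fst c" for q using that cA by (simp add: charts_at_def)
  have "vector_field A UNIV X"
    unfolding vector_field_def
  proof (intro conjI ballI)
    fix q show "X q \<in> tangent_space A q"
      using tangent_space_zero tangent_space_scaleR[OF coord_vec_in_tangent_space[OF at]]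
      by (simp add: X_def)
  next
    fix c' assume c': "c' \<in> A"
    let ?S1 = "snd c' ` (fst c' \<inter> fst c)" and ?S2 = "snd c' ` (fst c' \<inter> - K)"
    let ?t = "transition c' c"
    have S: "snd c' ` (fst c' \<inter> UNIV) = ?S1 \<union> ?S2" using Kc by auto
    have o1: "open ?S1" by (rule open_overlap[OF c' cA])
    have o2: "open ?S2" by (rule open_chart_image[OF c' K])
    have t: "smooth_on ?S1 ?t" by (rule smooth_transition[OF c' cA])
    have "smooth_on ?S1 (\<lambda>y. \<psi> (?t y) *\<^sub>R frechet_derivative (transition c c') (at (?t y)) (v c))"
    proof (rule smooth_on_scaleR[OF o1])
      show "smooth_on ?S1 (\<lambda>y. \<psi> (?t y))"
        by (rule smooth_on_compose[OF o1 open_UNIV t \<psi>(1)]) simp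
      show "smooth_on ?S1 (\<lambda>y. frechet_derivative (transition c c') (at (?t y)) (v c))"
        by (rule smooth_on_compose[OF o1 open_overlap[OF cA c'] t
              smooth_on_frechet_derivative[OF smooth_transition[OF cA c']]]) (use c' in auto)
    qed
    then have "smooth_on ?S1 (\<lambda>y. X (chart_inv c' y) c')"
    proof (rule smooth_on_cong[OF o1, rotated])
      fix y assume "y \<in> ?S1"
      then obtain q where q: "q \<in> fst c'" "q \<in> fst c" "y = snd c' q" by auto
      then have "c' \<in> charts_at A q" using c' by (simp add: charts_at_def)
      with q c' show "\<psi> (?t y) *\<^sub>R frechet_derivative (transition c c') (at (?t y)) (v c)
          = X (chart_inv c' y) c'"
        by (simp add: X_def scaleR_fun_def coord_vec_def)
    qed
    moreover have "smooth_on ?S2 (\<lambda>y. X (chart_inv c' y) c')"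
    proof (rule smooth_on_cong[OF o2 _ smooth_on_const[OF o2, of 0]])
      fix y assume "y \<in> ?S2"
      then obtain q where q: "q \<in> fst c'" "q \<notin> K" "y = snd c' q" by auto
      have "\<psi> (snd c q) = 0" if "q \<in> fst c"
        using q(2) chart_inv_coord[OF cA that] unfolding K_def by (intro \<psi>(3)) (metis imageI)
      then show "0 = X (chart_inv c' y) c'"
        using q c' by (simp add: X_def scaleR_fun_def)
    qed
    ultimately show "smooth_on (snd c' ` (fst c' \<inter> UNIV)) (\<lambda>y. X (chart_inv c' y) c')"
      unfolding S by (rule smooth_on_Un[OF o1 o2])
  qed
  moreover have "X p = v"
    using pc \<psi>(2) by (simp add: X_def coord_vec_of_tangent[OF c v])
  ultimately show thesis by (rule that)
qed

lemma smooth_fun_const: "smooth_fun A UNIV (\<lambda>p. r)"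
  unfolding smooth_fun_def by (intro ballI smooth_on_const open_chart_image open_UNIV)

lemma one_form_zero: "one_form A UNIV (\<lambda>p. 0)"
  unfolding one_form_def
proof (intro conjI ballI allI)
  show "0 \<in> cotangent_space A p" for p by (simp add: cotangent_space_def)
  fix c w assume "c \<in> A"
  then show "smooth_on (snd c ` (fst c \<inter> UNIV)) (form_coeff A (\<lambda>p. 0) c w)"
    unfolding form_coeff_def[abs_def] zero_fun_apply
    by (intro smooth_on_const open_chart_image open_UNIV)
qed

end

section \<open>Differential forms in charts\<close>

text \<open>At each point \<open>ext_deriv\<close> is this formula in some chosen chart. With the chart as a parameter, it can
  stay fixed while the point moves.\<close>

definition chart_ext_deriv ::
    "('a, 'e::euclidean_space) chart set \<Rightarrow> ('a \<Rightarrow> ('a, 'e) covec) \<Rightarrow> ('a, 'e) chart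
      \<Rightarrow> 'e \<Rightarrow> 'e \<Rightarrow> 'e \<Rightarrow> real" where
  "chart_ext_deriv A \<eta> c y u v = frechet_derivative (form_coeff A \<eta> c v) (at y) u
     - frechet_derivative (form_coeff A \<eta> c u) (at y) v"

lemma chart_ext_deriv_antisym: "chart_ext_deriv A \<eta> c y u v = - chart_ext_deriv A \<eta> c y v u"
  by (simp add: chart_ext_deriv_def)

lemma alternation_lead_pair_product_transport:
  assumes "\<And>i. i < 2 * m + 1 \<Longrightarrow> \<alpha> (v i) = \<alpha>' (w i)"
    and "\<And>i j. i < 2 * m + 1 \<Longrightarrow> j < 2 * m + 1 \<Longrightarrow> \<omega> (v i) (v j) = \<omega>' (w i) (w j)"
  shows "alternation (2 * m + 1) (lead_pair_product m \<alpha> \<omega>) v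
    = alternation (2 * m + 1) (lead_pair_product m \<alpha>' \<omega>') w"
proof -
  have "lead_pair_product m \<alpha> \<omega> (\<lambda>i. v (\<sigma> i)) = lead_pair_product m \<alpha>' \<omega>' (\<lambda>i. w (\<sigma> i))"
    if \<sigma>: "\<sigma> permutes {..<2 * m + 1}" for \<sigma>
  proof -
    have lt: "\<sigma> i < 2 * m + 1" if "i < 2 * m + 1" for i using permutes_in_image[OF \<sigma>, of i] that by simp
    show ?thesis unfolding lead_pair_product_def pair_product_def
      by (intro arg_cong2[where f = "(*)"] prod.cong refl assms lt) auto
  qed
  then show ?thesis unfolding alternation_def by (intro sum.cong) auto
qed

context
  fixes A :: "('a::{t2_space,second_countable_topology}, 'e::euclidean_space) chart set"
    and \<eta> :: "'a \<Rightarrow> ('a, 'e) covec"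
  assumes M: "smooth_manifold A" and \<eta>: "one_form A UNIV \<eta>"
begin

lemma open_chart_image_UNIV: "c \<in> A \<Longrightarrow> open (snd c ` fst c)"
  using open_chart_image[OF M _ open_UNIV] by simp

lemma smooth_form_coeff: "c \<in> A \<Longrightarrow> smooth_on (snd c ` fst c) (form_coeff A \<eta> c w)"
  using \<eta> by (simp add: one_form_def)

lemma form_coeff_at: "c \<in> charts_at A p \<Longrightarrow> form_coeff A \<eta> c w (snd c p) = \<eta> p (coord_vec A c p w)"
  using chart_inv_coord[OF M, of c p] by (simp add: form_coeff_def charts_at_def)

lemma linear_form_coeff:
  assumes c: "c \<in> charts_at A p"
  shows "linear (\<lambda>w. form_coeff A \<eta> c w (snd c p))"
proof (rule linearI)
  have cot: "\<eta> p \<in> cotangent_space A p" using \<eta> by (simp add: one_form_def)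
  note T = coord_vec_in_tangent_space[OF M c]
  show "form_coeff A \<eta> c (u + v) (snd c p) = form_coeff A \<eta> c u (snd c p) + form_coeff A \<eta> c v (snd c p)"
    for u v
    unfolding form_coeff_at[OF c] coord_vec_add[OF M c] using cot T unfolding cotangent_space_def by blast
  show "form_coeff A \<eta> c (r *\<^sub>R u) (snd c p) = r *\<^sub>R form_coeff A \<eta> c u (snd c p)" for r u
    unfolding form_coeff_at[OF c] coord_vec_scaleR[OF M c] real_scaleR_def
    using cot T unfolding cotangent_space_def by blast
qed

lemma form_coeff_expand:
  assumes "c \<in> charts_at A p"
  shows "form_coeff A \<eta> c w (snd c p) = (\<Sum>b\<in>Basis. (w \<bullet> b) * form_coeff A \<eta> c b (snd c p))"
proof -
  note lin = linear_form_coeff[OF assms]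
  have "form_coeff A \<eta> c (\<Sum>b\<in>Basis. (w \<bullet> b) *\<^sub>R b) (snd c p)
      = (\<Sum>b\<in>Basis. (w \<bullet> b) * form_coeff A \<eta> c b (snd c p))"
    by (simp add: linear_sum[OF lin] linear_cmul[OF lin])
  then show ?thesis by (simp add: euclidean_representation)
qed

lemma form_coeff_has_derivative:
  assumes "c \<in> charts_at A p"
  shows "(form_coeff A \<eta> c w has_derivative frechet_derivative (form_coeff A \<eta> c w) (at (snd c p)))
    (at (snd c p))"
  using assms by (intro smooth_on_has_derivative[OF smooth_form_coeff]) (auto simp: charts_at_def)

text \<open>The coefficients are linear in the direction \<open>w\<close> at every point of the chart, so this carries over
  to their derivatives.\<close>

lemma form_coeff_derivative_expand:
  assumes c: "c \<in> charts_at A p"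
  shows "frechet_derivative (form_coeff A \<eta> c w) (at (snd c p)) u
    = (\<Sum>b\<in>Basis. (w \<bullet> b) * frechet_derivative (form_coeff A \<eta> c b) (at (snd c p)) u)"
proof -
  have cA: "c \<in> A" and p: "snd c p \<in> snd c ` fst c" using c by (auto simp: charts_at_def)
  have "((\<lambda>y. \<Sum>b\<in>Basis. (w \<bullet> b) * form_coeff A \<eta> c b y) has_derivative
      (\<lambda>u. \<Sum>b\<in>Basis. (w \<bullet> b) * frechet_derivative (form_coeff A \<eta> c b) (at (snd c p)) u)) (at (snd c p))"
    by (intro has_derivative_sum has_derivative_mult_right form_coeff_has_derivative[OF c])
  then have "(form_coeff A \<eta> c w has_derivative
      (\<lambda>u. \<Sum>b\<in>Basis. (w \<bullet> b) * frechet_derivative (form_coeff A \<eta> c b) (at (snd c p)) u)) (at (snd c p))"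
  proof (rule has_derivative_transform_within_open[OF _ open_chart_image_UNIV[OF cA] p])
    fix y assume "y \<in> snd c ` fst c"
    then obtain q where "q \<in> fst c" "y = snd c q" by auto
    then show "(\<Sum>b\<in>Basis. (w \<bullet> b) * form_coeff A \<eta> c b y) = form_coeff A \<eta> c w y"
      using form_coeff_expand[of c q w, symmetric] cA by (simp only: charts_at_def mem_Collect_eq simp_thms)
  qed
  from fun_cong[OF frechet_derivative_at[OF this], of u] show ?thesis by (rule sym)
qed

lemma bilinear_chart_ext_deriv:
  assumes c: "c \<in> charts_at A p"
  shows "bilinear (chart_ext_deriv A \<eta> c (snd c p))"
proof -
  have 1: "linear (frechet_derivative (form_coeff A \<eta> c w) (at (snd c p)))" for w
    using form_coeff_has_derivative[OF c] by (rule has_derivative_linear)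
  have 2: "linear (\<lambda>w. frechet_derivative (form_coeff A \<eta> c w) (at (snd c p)) u)" for u
  proof -
    have "linear (\<lambda>w. \<Sum>b\<in>Basis. (w \<bullet> b) * frechet_derivative (form_coeff A \<eta> c b) (at (snd c p)) u)"
      by (rule linearI) (simp_all add: inner_add_left distrib_right sum.distrib sum_distrib_left mult.assoc)
    then show ?thesis
      by (subst form_coeff_derivative_expand[OF c])
  qed
  show ?thesis
    unfolding bilinear_def chart_ext_deriv_def[abs_def]
    using linear_compose_sub[OF 2 1] linear_compose_sub[OF 1 2] by blast
qed

text \<open>The coefficients in the chart \<open>c\<close> are those in \<open>c'\<close> in the moving direction \<open>D w\<close>. By the product
  rule, the derivative has a second term, in which the transition map is differentiated twice; it
  is symmetric in \<open>u\<close> and \<open>v\<close> by Schwarz's theorem and cancels in the antisymmetric combination.\<close>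

lemma chart_ext_deriv_change_chart:
  assumes c: "c \<in> charts_at A p" and c': "c' \<in> charts_at A p"
  defines "D \<equiv> frechet_derivative (transition c c') (at (snd c p))"
  shows "chart_ext_deriv A \<eta> c (snd c p) u v = chart_ext_deriv A \<eta> c' (snd c' p) (D u) (D v)"
proof -
  let ?t = "transition c c'" and ?a = "form_coeff A \<eta> c'" and ?y = "snd c p"
  let ?D = "\<lambda>w x. frechet_derivative ?t (at x) w"
  let ?U = "snd c ` (fst c \<inter> fst c')"
  have cA: "c \<in> A" "c' \<in> A" and p: "?y \<in> ?U" using c c' by (auto simp: charts_at_def)
  have U: "open ?U" by (rule open_overlap[OF M cA])
  have t: "smooth_on ?U ?t" by (rule smooth_transition[OF M cA])
  have at_y: "?t ?y = snd c' p" using transition_coord[OF M] c by (simp add: charts_at_def)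
  have der: "frechet_derivative (form_coeff A \<eta> c w) (at ?y) z
      = (\<Sum>b\<in>Basis. (frechet_derivative (?D w) (at ?y) z \<bullet> b) * ?a b (snd c' p))
        + frechet_derivative (?a (D w)) (at (snd c' p)) (D z)" for w z
  proof -
    let ?d = "\<lambda>z. \<Sum>b\<in>Basis. (?D w ?y \<bullet> b) * frechet_derivative (?a b) (at (snd c' p)) (D z)
          + (frechet_derivative (?D w) (at ?y) z \<bullet> b) * ?a b (snd c' p)"
    have "((\<lambda>x. ?a b (?t x)) has_derivative (\<lambda>z. frechet_derivative (?a b) (at (snd c' p)) (D z))) (at ?y)" for b
      using diff_chain_at[OF transition_has_derivative[OF M c c'], of "?a b"]
        form_coeff_has_derivative[OF c'] by (simp add: at_y o_def D_def)
    moreover have "((\<lambda>x. ?D w x \<bullet> b) has_derivative (\<lambda>z. frechet_derivative (?D w) (at ?y) z \<bullet> b)) (at ?y)" for b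
      by (rule bounded_linear.has_derivative[OF bounded_linear_inner_left
            smooth_on_has_derivative[OF smooth_on_frechet_derivative[OF t] p]])
    ultimately have "((\<lambda>x. \<Sum>b\<in>Basis. (?D w x \<bullet> b) * ?a b (?t x)) has_derivative ?d) (at ?y)"
      using has_derivative_mult[of "\<lambda>x. ?D w x \<bullet> b" _ ?y UNIV "\<lambda>x. ?a b (?t x)" for b]
      by (intro has_derivative_sum) (simp add: at_y)
    then have "(form_coeff A \<eta> c w has_derivative ?d) (at ?y)"
    proof (rule has_derivative_transform_within_open[OF _ U p])
      fix x assume "x \<in> ?U"
      then obtain q where q: "q \<in> fst c" "q \<in> fst c'" "x = snd c q" by auto
      then have cq: "c \<in> charts_at A q" "c' \<in> charts_at A q" using cA by (auto simp: charts_at_def)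
      have tq: "?t x = snd c' q" unfolding q(3) by (rule transition_coord[OF M cA(1) q(1)])
      have "form_coeff A \<eta> c w x = \<eta> q (coord_vec A c q w)"
        unfolding q(3) by (rule form_coeff_at[OF cq(1)])
      also have "\<dots> = \<eta> q (coord_vec A c' q (?D w x))"
        unfolding q(3) by (rule arg_cong[OF coord_vec_change_chart[OF M cq]])
      also have "\<dots> = ?a (?D w x) (snd c' q)"
        by (rule form_coeff_at[OF cq(2), symmetric])
      finally have "form_coeff A \<eta> c w x = ?a (?D w x) (snd c' q)" .
      then show "(\<Sum>b\<in>Basis. (?D w x \<bullet> b) * ?a b (?t x)) = form_coeff A \<eta> c w x"
        unfolding tq by (simp only: form_coeff_expand[OF cq(2), of "?D w x", symmetric])
    qed
    from fun_cong[OF frechet_derivative_at[OF this], of z]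
    have "frechet_derivative (form_coeff A \<eta> c w) (at ?y) z
      = (\<Sum>b\<in>Basis. (frechet_derivative (?D w) (at ?y) z \<bullet> b) * ?a b (snd c' p))
        + (\<Sum>b\<in>Basis. (D w \<bullet> b) * frechet_derivative (?a b) (at (snd c' p)) (D z))"
      unfolding sum.distrib D_def by (simp only: add.commute)
    then show ?thesis
      unfolding form_coeff_derivative_expand[OF c', of "D w"] .
  qed
  show ?thesis
    unfolding chart_ext_deriv_def der
    using second_derivative_symmetric_euclidean[OF U t p, of u v] by simp
qed

lemma ext_deriv_chart:
  assumes c: "c \<in> charts_at A p" and u: "u \<in> tangent_space A p" and v: "v \<in> tangent_space A p"
  shows "ext_deriv A \<eta> p u v = chart_ext_deriv A \<eta> c (snd c p) (u c) (v c)"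
proof -
  \<comment> \<open>the chart chosen in the definition of the exterior derivative\<close>
  define c0 where "c0 = (SOME c. c \<in> charts_at A p)"
  have c0: "c0 \<in> charts_at A p" unfolding c0_def using c by (rule someI)
  have D: "frechet_derivative (transition c c0) (at (snd c p)) (w c) = w c0" if "w \<in> tangent_space A p" for w
  proof -
    have "w c0 = frechet_derivative (transition c c0) (at (snd c p)) (w c)"
      using that c c0 unfolding tangent_space_def by blast
    then show ?thesis by (rule sym)
  qed
  have "ext_deriv A \<eta> p u v = chart_ext_deriv A \<eta> c0 (snd c0 p) (u c0) (v c0)"
    using u v by (simp add: ext_deriv_def chart_ext_deriv_def c0_def[symmetric])
  then show ?thesis
    unfolding chart_ext_deriv_change_chart[OF c c0] D[OF u] D[OF v] .
qed

lemma form_chart: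
  assumes c: "c \<in> charts_at A p" and u: "u \<in> tangent_space A p"
  shows "\<eta> p u = form_coeff A \<eta> c (u c) (snd c p)"
  using form_coeff_at[OF c] coord_vec_of_tangent[OF M c u] by simp

text \<open>An element of \<open>L\<^sub>\<eta>\<close> in the intersection has \<open>f = 0\<close> at \<open>p\<close>, and so its 1-form part is \<open>\<iota>\<^sub>u d\<eta>\<close>. For
  the converse, \<open>u\<close> has to be the value of a global vector field.\<close>

lemma L_form_Int_TM_R:
  "L_form A \<eta> p \<inter> TM_R_subbundle A p =
    {((u, 0), (0, - \<eta> p u)) | u. u \<in> tangent_space A p \<and> (\<forall>x\<in>tangent_space A p. ext_deriv A \<eta> p u x = 0)}"
  (is "?L = ?R")
proof (intro equalityI subsetI)
  fix e assume "e \<in> ?L"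
  then have "e \<in> L_form A \<eta> p" "e \<in> TM_R_subbundle A p" by auto
  then obtain X f u g where X: "vector_field A UNIV X"
    and "e = ((X p, f p), (ext_deriv A \<eta> p (X p) + f p *\<^sub>R \<eta> p, - \<eta> p (X p)))" "e = ((u, 0), (0, g))"
    unfolding L_form_def TM_R_subbundle_def by blast
  then have e: "f p = 0" "ext_deriv A \<eta> p (X p) = 0" "e = ((X p, 0), (0, - \<eta> p (X p)))" by auto
  with X show "e \<in> ?R" by (auto simp: vector_field_def)
next
  fix e assume "e \<in> ?R"
  then obtain u where u: "u \<in> tangent_space A p" "\<forall>x\<in>tangent_space A p. ext_deriv A \<eta> p u x = 0"
    and e: "e = ((u, 0), (0, - \<eta> p u))" by auto
  obtain X where X: "vector_field A UNIV X" "X p = u" by (rule tangent_vector_extends[OF M u(1)])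
  have "ext_deriv A \<eta> p u x = 0" for x
    using u(2) by (cases "x \<in> tangent_space A p") (auto simp: ext_deriv_def)
  then have "ext_deriv A \<eta> p u = 0" by (simp add: fun_eq_iff)
  then have "e \<in> L_form A \<eta> p"
    unfolding L_form_def e using X smooth_fun_const[OF M, of 0]
    by (intro CollectI exI[of _ X] exI[of _ "\<lambda>_. 0"]) simp
  then show "e \<in> ?L" using u(1) e by (auto simp: TM_R_subbundle_def)
qed

text \<open>The contact condition at a point is moved to the coordinate space by means of the isomorphism
  that takes a tangent vector to its coordinates.\<close>

lemma contact_at_chart:
  assumes c: "c \<in> charts_at A p"
  shows "(\<exists>v. (\<forall>i < 2 * n + 1. v i \<in> tangent_space A p) \<and>
        wedge 1 (2 * n) (\<lambda>v. \<eta> p (v 0))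
          (wedge_power 2 (\<lambda>v. ext_deriv A \<eta> p (v 0) (v 1)) n) v \<noteq> 0) \<longleftrightarrow>
    (\<exists>w. alternation (2 * n + 1) (lead_pair_product n
        (\<lambda>w. form_coeff A \<eta> c w (snd c p)) (chart_ext_deriv A \<eta> c (snd c p))) w \<noteq> 0)"
    (is "(\<exists>v. ?T v \<and> ?W v \<noteq> 0) \<longleftrightarrow> (\<exists>w. ?F w \<noteq> 0)")
proof -
  have eq: "?W v = ?F (\<lambda>i. v i c) / 2 ^ n" if "?T v" for v
    unfolding wedge_lead_power[where \<alpha> = "\<eta> p" and \<omega> = "ext_deriv A \<eta> p"]
    using that by (intro arg_cong2[where f = "(/)"] refl alternation_lead_pair_product_transport
        form_chart[OF c] ext_deriv_chart[OF c]) auto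
  show ?thesis
  proof
    assume "\<exists>v. ?T v \<and> ?W v \<noteq> 0"
    then obtain v where "?T v" "?W v \<noteq> 0" by blast
    with eq[of v] show "\<exists>w. ?F w \<noteq> 0" by auto
  next
    assume "\<exists>w. ?F w \<noteq> 0"
    then obtain w where w: "?F w \<noteq> 0" by blast
    let ?v = "\<lambda>i. coord_vec A c p (w i)"
    have T: "?T ?v" using coord_vec_in_tangent_space[OF M c] by blast
    have "?W ?v = ?F w / 2 ^ n" using eq[OF T] by (simp only: coord_vec_self[OF M c])
    with T w show "\<exists>v. ?T v \<and> ?W v \<noteq> 0" by (intro exI[of _ ?v] conjI) simp_all
  qed
qed

end

section \<open>The Reeb field\<close>

text \<open>This is the Reeb vector of contact geometry, with the additional requirement that the kernel of
  \<open>d\<eta>\<close> is no larger than its line.\<close>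

definition is_reeb_vector ::
    "('a, 'e::euclidean_space) chart set \<Rightarrow> ('a \<Rightarrow> ('a, 'e) covec) \<Rightarrow> 'a \<Rightarrow> ('a, 'e) tvec \<Rightarrow> bool" where
  "is_reeb_vector A \<eta> p \<xi> \<longleftrightarrow> \<xi> \<in> tangent_space A p \<and> \<eta> p \<xi> = 1 \<and>
     (\<forall>u\<in>tangent_space A p. (\<forall>x\<in>tangent_space A p. ext_deriv A \<eta> p u x = 0) \<longleftrightarrow> (\<exists>r. u = r *\<^sub>R \<xi>))"

context
  fixes A :: "('a::{t2_space,second_countable_topology}, 'e::euclidean_space) chart set"
    and \<eta> :: "'a \<Rightarrow> ('a, 'e) covec"
  assumes M: "smooth_manifold A" and \<eta>: "one_form A UNIV \<eta>"
begin

text \<open>The elements of the intersection are the \<open>(u, 0) + (0, - \<eta> u)\<close> with \<open>u\<close> in the kernel of \<open>d\<eta>\<close>, so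
  the coefficient \<open>-1\<close> of the generator encodes the normalization of \<open>\<xi>\<close>.\<close>

lemma L_form_Int_TM_R_eq_span:
  "L_form A \<eta> p \<inter> TM_R_subbundle A p = span {((\<xi>, 0), (0, -1))} \<longleftrightarrow> is_reeb_vector A \<eta> p \<xi>"
  (is "?I = span {?e} \<longleftrightarrow> _")
proof -
  let ?K = "{u \<in> tangent_space A p. \<forall>x\<in>tangent_space A p. ext_deriv A \<eta> p u x = 0}"
  have I: "?I = (\<lambda>u. ((u, 0), (0, - \<eta> p u))) ` ?K"
    unfolding L_form_Int_TM_R[OF M \<eta>] by blast
  have S: "span {?e} = range (\<lambda>r. ((r *\<^sub>R \<xi>, 0), (0, - r)))"
    by (simp add: span_singleton)
  have cmul: "\<eta> p (r *\<^sub>R u) = r * \<eta> p u" if "u \<in> tangent_space A p" for r u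
    using \<eta> that by (simp add: one_form_def cotangent_space_def)
  show ?thesis
  proof
    assume eq: "?I = span {?e}"
    have "?e \<in> ?I" unfolding eq by (simp add: span_base)
    then have \<xi>: "\<xi> \<in> ?K" "\<eta> p \<xi> = 1" unfolding I by auto
    have "u \<in> ?K \<longleftrightarrow> (\<exists>r. u = r *\<^sub>R \<xi>)" for u
    proof
      assume "u \<in> ?K"
      then have "((u, 0), (0, - \<eta> p u)) \<in> span {?e}" unfolding eq[symmetric] I by (rule imageI)
      then show "\<exists>r. u = r *\<^sub>R \<xi>" unfolding S by auto
    next
      assume "\<exists>r. u = r *\<^sub>R \<xi>"
      then obtain r where r: "u = r *\<^sub>R \<xi>" by blast
      have "((u, 0), (0, - r)) \<in> ?I" unfolding eq S r by (rule rangeI)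
      then show "u \<in> ?K" unfolding I by auto
    qed
    with \<xi> show "is_reeb_vector A \<eta> p \<xi>" unfolding is_reeb_vector_def by blast
  next
    assume sk: "is_reeb_vector A \<eta> p \<xi>"
    then have \<xi>: "\<xi> \<in> tangent_space A p" "\<eta> p \<xi> = 1" by (auto simp: is_reeb_vector_def)
    have "?K = range (\<lambda>r. r *\<^sub>R \<xi>)"
      using sk tangent_space_scaleR[OF M \<xi>(1)] unfolding is_reeb_vector_def by blast
    then have "?I = range (\<lambda>r. ((r *\<^sub>R \<xi>, 0), (0, - \<eta> p (r *\<^sub>R \<xi>))))"
      unfolding I by (simp add: image_image)
    then show "?I = span {?e}" unfolding S by (simp add: cmul \<xi>)
  qed
qed

text \<open>The properties of a Reeb vector pass to the coordinate space of a chart, where the linear algebra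
  takes place; \<open>is_reeb_vector_of_chart\<close> is the way back.\<close>

lemma is_reeb_vector_in_chart:
  assumes c: "c \<in> charts_at A p" and \<xi>: "is_reeb_vector A \<eta> p \<xi>"
  defines "\<alpha> \<equiv> \<lambda>w. form_coeff A \<eta> c w (snd c p)" and "\<omega> \<equiv> chart_ext_deriv A \<eta> c (snd c p)"
  shows "\<alpha> (\<xi> c) = 1" "\<omega> (\<xi> c) x = 0" "(\<And>x. \<omega> u x = 0) \<Longrightarrow> \<exists>r. u = r *\<^sub>R \<xi> c"
proof -
  note T = coord_vec_in_tangent_space[OF M c]
  have \<xi>T: "\<xi> \<in> tangent_space A p" using \<xi> by (simp add: is_reeb_vector_def)
  show "\<alpha> (\<xi> c) = 1"
    using \<xi> form_chart[OF M \<eta> c \<xi>T] by (simp add: is_reeb_vector_def \<alpha>_def)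
  have "\<exists>r. \<xi> = r *\<^sub>R \<xi>" by (rule exI[of _ 1]) simp
  then have "ext_deriv A \<eta> p \<xi> (coord_vec A c p x) = 0"
    using \<xi> T unfolding is_reeb_vector_def by blast
  then show "\<omega> (\<xi> c) x = 0"
    by (simp add: ext_deriv_chart[OF M \<eta> c \<xi>T T] coord_vec_self[OF M c] \<omega>_def)
  assume u: "\<And>x. \<omega> u x = 0"
  have "ext_deriv A \<eta> p (coord_vec A c p u) x = 0" if "x \<in> tangent_space A p" for x
    using u by (simp add: ext_deriv_chart[OF M \<eta> c T that] coord_vec_self[OF M c] \<omega>_def)
  then obtain r where "coord_vec A c p u = r *\<^sub>R \<xi>"
    using \<xi> T unfolding is_reeb_vector_def by blast
  then have "coord_vec A c p u c = r *\<^sub>R \<xi> c" by (simp add: scaleR_fun_def)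
  then show "\<exists>r. u = r *\<^sub>R \<xi> c" by (auto simp: coord_vec_self[OF M c])
qed

lemma is_reeb_vector_of_chart:
  assumes c: "c \<in> charts_at A p"
  defines "\<alpha> \<equiv> \<lambda>w. form_coeff A \<eta> c w (snd c p)" and "\<omega> \<equiv> chart_ext_deriv A \<eta> c (snd c p)"
  assumes z: "\<alpha> z = 1" "\<And>x. \<omega> z x = 0" "\<And>u. (\<And>x. \<omega> u x = 0) \<Longrightarrow> u = \<alpha> u *\<^sub>R z"
  shows "is_reeb_vector A \<eta> p (coord_vec A c p z)"
  unfolding is_reeb_vector_def
proof (intro conjI ballI)
  note T = coord_vec_in_tangent_space[OF M c]
  show "coord_vec A c p z \<in> tangent_space A p" by (rule T)
  show "\<eta> p (coord_vec A c p z) = 1"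
    using z(1) form_chart[OF M \<eta> c T] by (simp add: coord_vec_self[OF M c] \<alpha>_def)
  fix u assume u: "u \<in> tangent_space A p"
  show "(\<forall>x\<in>tangent_space A p. ext_deriv A \<eta> p u x = 0) \<longleftrightarrow> (\<exists>r. u = r *\<^sub>R coord_vec A c p z)"
  proof
    assume 0: "\<forall>x\<in>tangent_space A p. ext_deriv A \<eta> p u x = 0"
    have "\<omega> (u c) x = 0" for x
      using 0 T[of x] ext_deriv_chart[OF M \<eta> c u T[of x]] by (simp add: coord_vec_self[OF M c] \<omega>_def)
    from z(3)[OF this] have "u = coord_vec A c p (\<alpha> (u c) *\<^sub>R z)"
      using coord_vec_of_tangent[OF M c u] by metis
    then show "\<exists>r. u = r *\<^sub>R coord_vec A c p z"
      unfolding coord_vec_scaleR[OF M c] by (rule exI)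
  next
    assume "\<exists>r. u = r *\<^sub>R coord_vec A c p z"
    then obtain r where "u = r *\<^sub>R coord_vec A c p z" by blast
    then have "u c = r *\<^sub>R z" by (simp add: scaleR_fun_def coord_vec_self[OF M c])
    moreover have "linear (\<lambda>u. \<omega> u x)" for x
      using bilinear_chart_ext_deriv[OF M \<eta> c] by (simp add: bilinear_def \<omega>_def)
    ultimately have "\<omega> (u c) x = 0" for x using linear_cmul[of "\<lambda>u. \<omega> u x" r z] by (simp add: z(2))
    then show "\<forall>x\<in>tangent_space A p. ext_deriv A \<eta> p u x = 0"
      by (simp add: ext_deriv_chart[OF M \<eta> c u] \<omega>_def)
  qed
qed

lemma contact_form_if_reeb_vectors:
  assumes dim: "DIM('e) = 2 * n + 1" and \<xi>: "\<And>p. is_reeb_vector A \<eta> p (\<xi> p)"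
  shows "contact_form A n \<eta>"
  unfolding contact_form_def
proof
  fix p
  obtain c where c: "c \<in> charts_at A p" using charts_at_nonempty[OF M] by blast
  show "\<exists>v. (\<forall>i < 2 * n + 1. v i \<in> tangent_space A p) \<and>
        wedge 1 (2 * n) (\<lambda>v. \<eta> p (v 0))
          (wedge_power 2 (\<lambda>v. ext_deriv A \<eta> p (v 0) (v 1)) n) v \<noteq> 0"
    unfolding contact_at_chart[OF M \<eta> c]
    by (rule lead_pair_product_nonzero[OF linear_form_coeff[OF M \<eta> c] bilinear_chart_ext_deriv[OF M \<eta> c]
          chart_ext_deriv_antisym dim is_reeb_vector_in_chart[OF c \<xi>]])
qed

text \<open>At each point a Reeb vector exists by the formula in some chart. Since it is unique, its coordinates
  are given by the same formula in every other chart around the point; this shows that the field is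
  smooth in each chart.\<close>

lemma reeb_field_of_contact_form:
  assumes dim: "DIM('e) = 2 * n + 1" and contact: "contact_form A n \<eta>"
  obtains \<xi> where "vector_field A UNIV \<xi>" "\<And>p. is_reeb_vector A \<eta> p (\<xi> p)"
proof -
  let ?\<alpha> = "\<lambda>c y w. form_coeff A \<eta> c w y" and ?\<omega> = "chart_ext_deriv A \<eta>"
  obtain b :: "nat \<Rightarrow> 'e" where b: "bij_betw b {..<2 * n + 1} Basis"
    using ex_bij_betw_nat_finite[of "Basis :: 'e set"] dim by (auto simp: lessThan_atLeast0)
  let ?F = "\<lambda>c y. alternation (2 * n + 1) (lead_pair_product n (?\<alpha> c y) (?\<omega> c y)) b"
  let ?R = "\<lambda>c y. reeb_vector n (?\<alpha> c y) (?\<omega> c y) b"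
  have nz: "?F c (snd c p) \<noteq> 0" if c: "c \<in> charts_at A p" for c p
  proof
    assume 0: "?F c (snd c p) = 0"
    have "\<exists>w. alternation (2 * n + 1) (lead_pair_product n (?\<alpha> c (snd c p)) (?\<omega> c (snd c p))) w \<noteq> 0"
      unfolding contact_at_chart[OF M \<eta> c, symmetric] using contact unfolding contact_form_def by blast
    then show False
      using alternation_eq_0_if_basis[OF lead_pair_product_cong
        linear_lead_pair_product[OF linear_form_coeff[OF M \<eta> c] bilinear_chart_ext_deriv[OF M \<eta> c]] b 0]
      by blast
  qed
  note reeb = reeb_vector[OF linear_form_coeff[OF M \<eta>] bilinear_chart_ext_deriv[OF M \<eta>]
      chart_ext_deriv_antisym b nz]
  have "\<forall>p. \<exists>u. is_reeb_vector A \<eta> p u"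
  proof
    fix p
    obtain c where c: "c \<in> charts_at A p" using charts_at_nonempty[OF M] by blast
    show "\<exists>u. is_reeb_vector A \<eta> p u"
      by (rule exI) (rule is_reeb_vector_of_chart[OF c reeb[OF c c c]])
  qed
  then obtain \<xi> where sk: "\<And>p. is_reeb_vector A \<eta> p (\<xi> p)" by (auto dest: choice)
  have chart: "\<xi> p c = ?R c (snd c p)" if c: "c \<in> charts_at A p" for c p
    using reeb(3)[OF c c c is_reeb_vector_in_chart(2)[OF c sk]] is_reeb_vector_in_chart(1)[OF c sk] by simp
  have "vector_field A UNIV \<xi>"
    unfolding vector_field_def
  proof (intro conjI ballI)
    show "\<xi> p \<in> tangent_space A p" for p using sk by (simp add: is_reeb_vector_def)
    fix c assume cA: "c \<in> A"
    note S = open_chart_image[OF M cA open_UNIV]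
    have coeff: "smooth_on (snd c ` (fst c \<inter> UNIV)) (form_coeff A \<eta> c w)" for w
      using smooth_form_coeff[OF M \<eta> cA] by simp
    have "smooth_on (snd c ` (fst c \<inter> UNIV)) (?R c)"
    proof (rule smooth_on_reeb_vector[OF S coeff])
      show "smooth_on (snd c ` (fst c \<inter> UNIV)) (\<lambda>y. ?\<omega> c y (b i) (b j))" for i j
        unfolding chart_ext_deriv_def
        by (rule smooth_on_diff[OF S smooth_on_frechet_derivative[OF coeff] smooth_on_frechet_derivative[OF coeff]])
      show "?F c y \<noteq> 0" if y: "y \<in> snd c ` (fst c \<inter> UNIV)" for y
      proof -
        obtain p where "p \<in> fst c" "y = snd c p" using y by auto
        then show ?thesis using nz[of c p] cA by (simp add: charts_at_def)
      qed
    qed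
    then show "smooth_on (snd c ` (fst c \<inter> UNIV)) (\<lambda>y. \<xi> (chart_inv c y) c)"
    proof (rule smooth_on_cong[OF S, rotated])
      fix y assume "y \<in> snd c ` (fst c \<inter> UNIV)"
      then obtain p where "p \<in> fst c" "y = snd c p" by auto
      with cA show "?R c y = \<xi> (chart_inv c y) c"
        using chart[of c p] chart_inv_coord[OF M cA, of p] by (simp add: charts_at_def)
    qed
  qed
  then show thesis using sk by (rule that)
qed

end

theorem theorem2p4:
  fixes A :: "('a::{t2_space,second_countable_topology}, 'e::euclidean_space) chart set"
    and \<eta> :: "'a \<Rightarrow> ('a, 'e) covec"
    and n :: nat
  assumes "smooth_manifold A"
    and "DIM('e) = 2 * n + 1"
    and "one_form A UNIV \<eta>"
  shows "contact_form A n \<eta> \<longleftrightarrow>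
    E1_subbundle A 1 (\<lambda>p. L_form A \<eta> p \<inter> TM_R_subbundle A p) \<and>
    (\<exists>\<xi>. vector_field A UNIV \<xi> \<and>
      (\<forall>p. L_form A \<eta> p \<inter> TM_R_subbundle A p = span {((\<xi> p, 0), (0, -1))}))"
proof
  assume "contact_form A n \<eta>"
  then obtain \<xi> where \<xi>: "vector_field A UNIV \<xi>" "\<And>p. is_reeb_vector A \<eta> p (\<xi> p)"
    using reeb_field_of_contact_form[OF assms(1,3,2)] by blast
  let ?s = "\<lambda>p. ((\<xi> p, 0), (0, -1)) :: ('a, 'e) E1vec"
  have span: "L_form A \<eta> p \<inter> TM_R_subbundle A p = span {?s p}" for p
    unfolding L_form_Int_TM_R_eq_span[OF assms(1,3)] by (rule \<xi>(2))
  have "E1_section A UNIV ?s"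
    using \<xi>(1) smooth_fun_const[OF assms(1)] one_form_zero[OF assms(1)] by (simp add: E1_section_def)
  moreover have "independent {?s p}" for p by (simp add: zero_prod_def)
  ultimately have "E1_subbundle A 1 (\<lambda>p. L_form A \<eta> p \<inter> TM_R_subbundle A p)"
    unfolding E1_subbundle_def span
    by (intro allI exI[of _ UNIV] exI[of _ "\<lambda>i. ?s"]) (simp add: lessThan_Suc)
  with \<xi>(1) span show "E1_subbundle A 1 (\<lambda>p. L_form A \<eta> p \<inter> TM_R_subbundle A p) \<and>
    (\<exists>\<xi>. vector_field A UNIV \<xi> \<and>
      (\<forall>p. L_form A \<eta> p \<inter> TM_R_subbundle A p = span {((\<xi> p, 0), (0, -1))}))" by blast
next
  assume "E1_subbundle A 1 (\<lambda>p. L_form A \<eta> p \<inter> TM_R_subbundle A p) \<and>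
    (\<exists>\<xi>. vector_field A UNIV \<xi> \<and>
      (\<forall>p. L_form A \<eta> p \<inter> TM_R_subbundle A p = span {((\<xi> p, 0), (0, -1))}))"
  then obtain \<xi> where "\<And>p. L_form A \<eta> p \<inter> TM_R_subbundle A p = span {((\<xi> p, 0), (0, -1))}" by blast
  then show "contact_form A n \<eta>"
    unfolding L_form_Int_TM_R_eq_span[OF assms(1,3)]
    by (rule contact_form_if_reeb_vectors[OF assms(1,3,2)])
qed

end
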